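(* Let $n,p,m\in\mathbb N$, let $\lambda\ge\mu\ge 0$, $l\ge 0$, $\delta\ge0$ be real, let $-1\le A<B\le 1$, $0<B\le 1$, and let $0\le\sigma_j<p$ for $j=1,\dots,m$. If $f_j(z)=z^p-\sum_{k=n+p}^\infty|a_{k,j}|z^k\in\widetilde{\mathcal P}_{\lambda,\mu,l}^{\delta}(A,B;\sigma_j,p)$ for $j=1,\dots,m$, then $$(f_1\bullet f_2\bullet\cdots\bullet f_m)(z)\in\widetilde{\mathcal P}_{\lambda,\mu,l}^{\delta}(A,B;\Upsilon,p),$$ where $$\Upsilon:=p-\frac{\prod_{j=1}^m(B-A)(p-\sigma_j)}{(B-A)\left[(n+p)(1+B)\Phi_p^{n+p}(\delta,\lambda,\mu,l)\right]^{m-1}}.$$ The result is sharp for the functions $$f_j(z)=z^p-\frac{(B-A)(p-\sigma_j)}{(n+p)(1+B)\Phi_p^{n+p}(\delta,\lambda,\mu,l)}z^{p+n}\qquad(j=1,\dots,m),$$ i.e. for these functions $\Upsilon$ cannot be replaced by any larger number.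
   Context: $\mathbb N=\{1,2,3,\dots\}$ and $\mathcal U=\{z\in\mathbb C:|z|<1\}$. $\mathcal A(n,p)$ is the class of functions $f(z)=z^p+\sum_{k=n+p}^\infty a_kz^k$ that are analytic and $p$-valent in $\mathcal U$ ($p$-valent: no value is taken more than $p$ times in $\mathcal U$, counted with multiplicity, and some value is taken exactly $p$ times). For $k\ge n+p$ put $$\Phi_p^k(\delta,\lambda,\mu,l)=\left[\frac{(k-p)(\lambda\mu k+\lambda-\mu)+p+l}{p+l}\right]^{\delta},\qquad \mathcal J_p^\delta(\lambda,\mu,l)f(z)=z^p+\sum_{k=n+p}^\infty\Phi_p^k(\delta,\lambda,\mu,l)\,a_kz^k .$$ For $F,G$ analytic in $\mathcal U$, $F\prec G$ (subordination) means $F(z)=G(w(z))$ in $\mathcal U$ for some analytic $w:\mathcal U\to\mathbb C$ with $w(0)=0$, $|w(z)|<1$. For $0\le\sigma<p$, the class $\mathcal P_{\lambda,\mu,l}^{\delta}(A,B;\sigma,p)$ consists of all $f\in\mathcal A(n,p)$ with $$\frac1{p-\sigma}\left(\frac{[\mathcal J_p^\delta(\lambda,\mu,l)f(z)]'}{z^{p-1}}-\sigma\right)\prec\frac{1+Az}{1+Bz}\quad(z\in\mathcal U)$$ (the quotient by $z^{p-1}$ being extended analytically to $z=0$), and $\widetilde{\mathcal P}_{\lambda,\mu,l}^{\delta}(A,B;\sigma,p)$ is the subclass of those $f$ of the form $f(z)=z^p-\sum_{k=n+p}^\infty|a_k|z^k$. The quasi-convolution of $f_1,f_2$, where $f_j(z)=z^p-\sum_{k=n+p}^\infty|a_{k,j}|z^k$,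 is $(f_1\bullet f_2)(z)=z^p-\sum_{k=n+p}^\infty|a_{k,1}||a_{k,2}|z^k$; it is iterated for more factors. *)

theory Defs
  imports "HOL-Complex_Analysis.Complex_Analysis"
begin

abbreviation unit_disc :: "complex set" where
  "unit_disc \<equiv> ball 0 1"

text \<open>A locally constant function takes one of its values on an infinite set, so requiring finite
  fibres only excludes functions with a value of infinite multiplicity; it is what makes the sum of
  the orders meaningful (a sum over an infinite set would be \<open>0\<close>).\<close>

definition p_valent :: "nat \<Rightarrow> (complex \<Rightarrow> complex) \<Rightarrow> bool" where
  "p_valent p f \<longleftrightarrow>
     (\<forall>c. finite {z \<in> unit_disc. f z = c} \<and>
          (\<Sum>z \<in> {z \<in> unit_disc. f z = c}. zorder (\<lambda>u. f u - c) z) \<le> int p) \<and>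
     (\<exists>c. (\<Sum>z \<in> {z \<in> unit_disc. f z = c}. zorder (\<lambda>u. f u - c) z) = int p)"

text \<open>Here and below, power series \<open>\<Sum>k\<ge>n+p. a k * z^k\<close> are written with the shifted index \<open>n + p + k\<close>.
  Functions are total on \<open>\<complex>\<close>, but only their values on the unit disc are constrained.\<close>

definition class_A :: "nat \<Rightarrow> nat \<Rightarrow> (complex \<Rightarrow> complex) set" where
  "class_A n p = {f. f holomorphic_on unit_disc \<and> p_valent p f \<and>
     (\<exists>a :: nat \<Rightarrow> complex. \<forall>z \<in> unit_disc.
        (\<lambda>k. a (n + p + k) * z ^ (n + p + k)) sums (f z - z ^ p))}"

definition Phi :: "nat \<Rightarrow> real \<Rightarrow> real \<Rightarrow> real \<Rightarrow> real \<Rightarrow> nat \<Rightarrow> real" where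
  "Phi p \<delta> lam \<mu> l k =
     (((real k - real p) * (lam * \<mu> * real k + lam - \<mu>) + real p + l) / (real p + l)) powr \<delta>"

definition J_op :: "nat \<Rightarrow> nat \<Rightarrow> real \<Rightarrow> real \<Rightarrow> real \<Rightarrow> real
    \<Rightarrow> (complex \<Rightarrow> complex) \<Rightarrow> complex \<Rightarrow> complex" where
  "J_op n p \<delta> lam \<mu> l f z = z ^ p +
     (\<Sum>k. of_real (Phi p \<delta> lam \<mu> l (n + p + k)) * fps_nth (fps_expansion f 0) (n + p + k)
           * z ^ (n + p + k))"

definition subordinate :: "(complex \<Rightarrow> complex) \<Rightarrow> (complex \<Rightarrow> complex) \<Rightarrow> bool" where
  "subordinate F G \<longleftrightarrow> F holomorphic_on unit_disc \<and> G holomorphic_on unit_disc \<and>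
     (\<exists>w. w holomorphic_on unit_disc \<and> w 0 = 0 \<and>
          (\<forall>z \<in> unit_disc. norm (w z) < 1 \<and> F z = G (w z)))"

text \<open>\<open>remove_sings\<close> extends the quotient by \<open>z^(p-1)\<close> analytically to \<open>z = 0\<close>.
  The two classes below are meant for \<open>0 \<le> \<sigma> < p\<close> only.\<close>

definition class_P :: "nat \<Rightarrow> nat \<Rightarrow> real \<Rightarrow> real \<Rightarrow> real \<Rightarrow> real \<Rightarrow> real \<Rightarrow> real \<Rightarrow> real
    \<Rightarrow> (complex \<Rightarrow> complex) set" where
  "class_P n p \<delta> lam \<mu> l A B \<sigma> = {f \<in> class_A n p.
     subordinate
       (\<lambda>z. 1 / of_real (real p - \<sigma>) *
              (remove_sings (\<lambda>u. deriv (J_op n p \<delta> lam \<mu> l f) u / u ^ (p - 1)) z - of_real \<sigma>))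
       (\<lambda>z. (1 + of_real A * z) / (1 + of_real B * z))}"

definition class_P_neg :: "nat \<Rightarrow> nat \<Rightarrow> real \<Rightarrow> real \<Rightarrow> real \<Rightarrow> real \<Rightarrow> real \<Rightarrow> real \<Rightarrow> real
    \<Rightarrow> (complex \<Rightarrow> complex) set" where
  "class_P_neg n p \<delta> lam \<mu> l A B \<sigma> = {f \<in> class_P n p \<delta> lam \<mu> l A B \<sigma>.
     \<exists>a :: nat \<Rightarrow> complex. \<forall>z \<in> unit_disc.
        (\<lambda>k. of_real (norm (a (n + p + k))) * z ^ (n + p + k)) sums (z ^ p - f z)}"

definition quasi_conv :: "nat \<Rightarrow> nat \<Rightarrow> (complex \<Rightarrow> complex) \<Rightarrow> (complex \<Rightarrow> complex)
    \<Rightarrow> complex \<Rightarrow> complex" where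
  "quasi_conv n p f g z = z ^ p -
     (\<Sum>k. of_real (norm (fps_nth (fps_expansion f 0) (n + p + k))
                 * norm (fps_nth (fps_expansion g 0) (n + p + k))) * z ^ (n + p + k))"

text \<open>\<open>f 1 \<bullet> f 2 \<bullet> \<dots> \<bullet> f m\<close>, associated to the left; for \<open>m = 1\<close> it is \<open>f 1\<close> itself.\<close>

definition quasi_conv_upto :: "nat \<Rightarrow> nat \<Rightarrow> nat \<Rightarrow> (nat \<Rightarrow> complex \<Rightarrow> complex)
    \<Rightarrow> complex \<Rightarrow> complex" where
  "quasi_conv_upto n p m f = foldl (quasi_conv n p) (f 1) (map f [2..<Suc m])"

end

theory Submission
  imports Defs
begin

text \<open>
  Membership in the class with negative coefficients is equivalent to one linear inequality on the
  coefficients. If \<open>f(z) = z\<^sup>p - \<Sum> c\<^sub>k z\<^sup>k\<close> with \<open>c\<^sub>k \<ge> 0\<close>, then \<open>f\<close> lies in the class of order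
  \<open>\<sigma>\<close> if and only if
  \<open>\<Sum> k (1 + B) \<Phi>\<^sub>k c\<^sub>k \<le> (B - A)(p - \<sigma>)\<close>. Necessity
  (\<open>class_P_neg_imp_coeff_bound\<close>) comes from real \<open>z\<close> tending to \<open>1\<close>, where the subordinate
  function is real and cannot fall below \<open>(1 + A)/(1 + B)\<close>. Sufficiency
  (\<open>coeff_bound_imp_class_P_neg\<close>) comes from solving the subordination for the inner function.

  Sufficiency also requires that \<open>f\<close> be p-valent, and the inequality gives this because
  \<open>f'(z)/z\<^bsup>p-1\<^esup>\<close> then has positive real part in the disc. That this implies p-valence
  (\<open>p_valent_of_Re_deriv_pos\<close>) is an instance of the theory of p-valently close-to-convex functions.
  The proof here applies the argument principle to \<open>(f - c)/z\<^sup>p\<close> on a circle: this closed curve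
  crosses the negative real axis in one direction only, so it cannot wind positively about \<open>0\<close>, and
  \<open>f - c\<close> has at most \<open>p\<close> zeros.

  The rest is an estimate on sequences (\<open>coeff_bound_quasi_conv\<close>). The weights
  \<open>k (1 + B) \<Phi>\<^sub>k\<close> increase with \<open>k\<close>, so the inequality for \<open>f\<^sub>2\<close> bounds each of its coefficients
  by \<open>(B - A)(p - \<sigma>\<^sub>2)\<close> divided by the weight at \<open>n + p\<close>. Multiplying coefficients therefore
  multiplies the bounds and divides by that weight, and iterating gives \<open>\<Upsilon>\<close>. For functions with the
  single coefficient at \<open>n + p\<close> every step is an equality, which is sharpness.
\<close>

section \<open>p-valence from a positive real part\<close>

text \<open>A continuous argument along \<open>q\<close> that gains a full turn must at some first time reach an odd
  multiple of \<open>\<pi>\<close> from below. Just before that time \<open>q\<close> lies in the upper half-plane, so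
  \<open>Im q\<close> is not increasing there.\<close>

lemma winding_number_le_0_if_cut_crossed_upwards:
  fixes q :: "real \<Rightarrow> complex"
  assumes "path q" "pathfinish q = pathstart q" "0 \<notin> path_image q"
    and up: "\<And>t. t \<in> {0..1} \<Longrightarrow> q t \<in> \<real>\<^sub>\<le>\<^sub>0 \<Longrightarrow>
      \<exists>D>0. ((\<lambda>s. Im (q s)) has_real_derivative D) (at t within {0..1})"
  shows "Re (winding_number q 0) \<le> 0"
proof (rule ccontr)
  assume neg: "\<not> Re (winding_number q 0) \<le> 0"
  have "winding_number q 0 \<in> \<int>"
    using assms by (simp add: integer_winding_number)
  then obtain w :: int where w: "winding_number q 0 = of_int w"
    by (auto elim: Ints_cases)
  with neg have "1 \<le> w" by auto
  obtain L where L: "path L" "pathfinish L - pathstart L = 2 * of_real pi * \<i> * winding_number q 0"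
      "\<And>t. t \<in> {0..1} \<Longrightarrow> q t = 0 + exp (L t)"
    using winding_number_as_continuous_log[OF assms(1,3)] by blast
  define \<phi> where "\<phi> = (\<lambda>t. Im (L t))"
  have cont: "continuous_on {0..1} \<phi>"
    using L(1) unfolding \<phi>_def path_def by (intro continuous_intros)
  have "\<phi> 1 - \<phi> 0 = Im (pathfinish L - pathstart L)"
    by (simp add: \<phi>_def pathfinish_def pathstart_def)
  also have "\<dots> = 2 * pi * w"
    by (simp add: L(2) w)
  finally have "\<phi> 1 - \<phi> 0 = 2 * pi * w" .
  moreover have "2 * pi * 1 \<le> 2 * pi * w"
    using \<open>1 \<le> w\<close> by (intro mult_left_mono) auto
  ultimately have turn: "\<phi> 0 + 2 * pi \<le> \<phi> 1" by linarith
  \<comment> \<open>\<open>v\<close> is the odd multiple of \<open>\<pi>\<close> lying in the first turn after \<open>\<phi> 0\<close>; \<open>t0\<close> below is the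
    first time at which the argument reaches it.\<close>
  define k where "k = \<lfloor>(\<phi> 0 + pi) / (2 * pi)\<rfloor>"
  define v where "v = pi + 2 * pi * of_int k"
  have "of_int k \<le> (\<phi> 0 + pi) / (2 * pi)" "(\<phi> 0 + pi) / (2 * pi) < of_int k + 1"
    unfolding k_def by linarith+
  then have v: "\<phi> 0 < v" "v \<le> \<phi> 0 + 2 * pi"
    by (simp_all add: v_def field_simps)
  define T where "T = {t \<in> {0..1}. v \<le> \<phi> t}"
  have "T = {0..1} \<inter> \<phi> -` {v..}" by (auto simp: T_def)
  moreover have "closed ({0..1} \<inter> \<phi> -` {v..})"
    by (rule continuous_closed_preimage[OF cont]) auto
  ultimately have "compact T"
    by (metis compact_Icc compact_Int_closed inf.left_idem)
  moreover have "1 \<in> T" using v turn by (auto simp: T_def)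
  ultimately obtain t0 where t0: "t0 \<in> T" "\<And>t. t \<in> T \<Longrightarrow> t0 \<le> t"
    using compact_attains_inf[of T] by auto
  have t0I: "0 \<le> t0" "t0 \<le> 1" "v \<le> \<phi> t0" using t0 by (auto simp: T_def)
  have "\<exists>t\<ge>0. t \<le> t0 \<and> \<phi> t = v"
    using t0I v by (intro IVT' continuous_on_subset[OF cont]) auto
  then obtain t1 where t1: "0 \<le> t1" "t1 \<le> t0" "\<phi> t1 = v" by blast
  then have "t0 \<le> t1" using t0I by (intro t0(2)) (auto simp: T_def)
  with t1 have vt0: "\<phi> t0 = v" by auto
  with v have "t0 \<noteq> 0" by auto
  have cv: "cos v = -1" "sin v = 0"
    by (simp_all add: v_def sin_add cos_add cos_int_2pin sin_int_2pin)
  have q0: "Im (q t0) = 0" "Re (q t0) \<le> 0"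
    using t0I vt0 cv L(3)[of t0] by (auto simp: \<phi>_def Re_exp Im_exp)
  then have "q t0 \<in> \<real>\<^sub>\<le>\<^sub>0" by (simp add: complex_nonpos_Reals_iff)
  then obtain D where "D > 0" "((\<lambda>s. Im (q s)) has_real_derivative D) (at t0 within {0..1})"
    using up[of t0] t0I by auto
  then obtain d where d: "d > 0" "\<And>h. h > 0 \<Longrightarrow> t0 - h \<in> {0..1} \<Longrightarrow> h < d \<Longrightarrow> Im (q (t0 - h)) < Im (q t0)"
    using has_real_derivative_pos_inc_left by blast
  obtain e where e: "e > 0" "\<And>t. t \<in> {0..1} \<Longrightarrow> dist t t0 < e \<Longrightarrow> dist (\<phi> t) (\<phi> t0) < pi"
    using cont t0I pi_gt_zero unfolding continuous_on_iff by (metis atLeastAtMost_iff)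
  define h where "h = min (d / 2) (min (e / 2) t0)"
  have h: "0 < h" "h < d" "h < e" "h \<le> t0"
    using d e t0I \<open>t0 \<noteq> 0\<close> by (auto simp: h_def min_def)
  then have hI: "t0 - h \<in> {0..1}" using t0I by auto
  have "t0 - h \<notin> T" using t0(2)[of "t0 - h"] h by auto
  then have 1: "\<phi> (t0 - h) < v" using hI by (auto simp: T_def)
  have "dist (\<phi> (t0 - h)) v < pi"
    using e(2)[OF hI] h vt0 by (auto simp: dist_real_def)
  then have 2: "v - pi < \<phi> (t0 - h)" by (auto simp: dist_real_def)
  \<comment> \<open>Slightly before \<open>t0\<close> the argument is in \<open>(v - \<pi>, v)\<close>, which is the upper half-plane.\<close>
  have "sin (\<phi> (t0 - h)) = sin (v - (v - \<phi> (t0 - h)))" by simp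
  also have "\<dots> = sin (v - \<phi> (t0 - h))"
    by (subst sin_diff) (simp add: cv)
  also have "\<dots> > 0" using 1 2 by (intro sin_gt_zero) auto
  finally have "Im (q (t0 - h)) > 0"
    using L(3)[OF hI] by (simp add: Im_exp \<phi>_def)
  with d(2)[OF h(1) hI h(2)] q0 show False by simp
qed

lemma not_constant_of_Re_deriv_pos:
  fixes f h :: "complex \<Rightarrow> complex"
  assumes der: "\<And>z. z \<in> ball 0 1 \<Longrightarrow> deriv f z = z ^ k * h z"
    and pos: "\<And>z. z \<in> ball 0 1 \<Longrightarrow> Re (h z) > 0"
  shows "\<not> (\<lambda>z. f z - c) constant_on ball 0 1"
proof
  assume "(\<lambda>z. f z - c) constant_on ball 0 1"
  then obtain a where a: "\<And>z. z \<in> ball 0 1 \<Longrightarrow> f z - c = a" by (auto simp: constant_on_def)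
  have "deriv f (1/2) = deriv (\<lambda>_. a + c) (1/2)"
    using a by (intro deriv_cong_ev eventually_nhds_in_open[THEN eventually_mono, of "ball 0 1"])
      (auto simp: algebra_simps)
  then show False using der[of "1/2"] pos[of "1/2"] by auto
qed

text \<open>By the argument principle, \<open>f\<close> takes the value \<open>c\<close> in the disc of radius \<open>r\<close> exactly
  \<open>p + W\<close> times, where \<open>W\<close> is the winding number about \<open>0\<close> of \<open>Q = (f - c)/z\<^sup>p\<close> along the circle.
  In the angle \<open>\<theta>\<close>, \<open>dQ/d\<theta> = \<i> (h - p Q)\<close>, whose imaginary part \<open>Re h - p Re Q\<close> is positive
  wherever \<open>Q\<close> is real and negative. The negative axis is thus only crossed upwards, and
  \<open>W \<le> 0\<close>.\<close>

lemma sum_zorder_le_of_Re_deriv_pos: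
  fixes f h :: "complex \<Rightarrow> complex"
  assumes holf: "f holomorphic_on ball 0 1" and p: "1 \<le> p"
    and der: "\<And>z. z \<in> ball 0 1 \<Longrightarrow> deriv f z = z ^ (p - 1) * h z"
    and pos: "\<And>z. z \<in> ball 0 1 \<Longrightarrow> Re (h z) > 0"
    and r: "0 < r" "r < 1" and nz: "\<And>z. norm z = r \<Longrightarrow> f z \<noteq> c"
  shows "(\<Sum>z \<in> {z \<in> ball 0 r. f z = c}. zorder (\<lambda>u. f u - c) z) \<le> int p"
proof -
  \<comment> \<open>A slightly larger disc, on which the argument principle is applied: its closure is compact
    in the unit disc, so it contains only finitely many zeros.\<close>
  define R where "R = (1 + r) / 2"
  have R: "r < R" "R < 1" using r by (auto simp: R_def)
  define u where "u = (\<lambda>z. f z - c)"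
  define g where "g = circlepath 0 r"
  have holu: "u holomorphic_on ball 0 R"
    unfolding u_def using R by (intro holomorphic_intros holomorphic_on_subset[OF holf]) auto
  have fd: "(f has_field_derivative deriv f z) (at z)" if "norm z < 1" for z
    using that by (intro holomorphic_derivI[OF holf]) auto
  then have ud: "(u has_field_derivative deriv f z) (at z)" if "norm z < 1" for z
    unfolding u_def using that by (auto intro!: derivative_eq_intros)
  then have du: "deriv u z = deriv f z" if "norm z < 1" for z
    using that by (auto intro: DERIV_imp_deriv)
  have "\<not> u constant_on ball 0 1"
    unfolding u_def by (rule not_constant_of_Re_deriv_pos[OF der pos])
  then have "finite {z \<in> cball 0 R. u z = 0}"
    using R by (intro holomorphic_compact_finite_zeros[of u "ball 0 1"])
      (auto simp: u_def intro!: holomorphic_intros holf)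
  then have fin: "finite {z \<in> ball 0 R. u z = 0}"
    by (rule rev_finite_subset) auto
  have g: "valid_path g" "pathfinish g = pathstart g" "path_image g = sphere 0 r"
    using r by (auto simp: g_def)
  have unz: "u z \<noteq> 0" if "norm z = r" for z using nz that by (auto simp: u_def)
  define N where "N = (\<Sum>z \<in> {z \<in> ball 0 r. f z = c}. zorder u z)"
  have "contour_integral g (\<lambda>x. deriv u x * 1 / u x) = 2 * pi * \<i> *
      (\<Sum>z\<in>{z\<in>ball 0 R. u z = 0 \<or> z \<in> {}}. winding_number g z * 1 * zorder u z)"
  proof (rule argument_principle)
    show "\<forall>z. z \<notin> ball 0 R \<longrightarrow> winding_number g z = 0"
      using g R by (auto intro!: winding_number_zero_outside[of g "cball 0 r"] simp: valid_path_imp_path)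
    show "path_image g \<subseteq> ball 0 R - {w \<in> ball 0 R. u w = 0 \<or> w \<in> {}}"
      using g R unz by auto
  qed (use holu g fin in auto)
  also have "(\<Sum>z\<in>{z\<in>ball 0 R. u z = 0 \<or> z \<in> {}}. winding_number g z * 1 * zorder u z)
      = (\<Sum>z\<in>{z\<in>ball 0 r. f z = c}. of_int (zorder u z))"
  proof (rule sum.mono_neutral_cong_right)
    show "finite {z \<in> ball 0 R. u z = 0 \<or> z \<in> {}}" using fin by simp
    show "{z \<in> ball 0 r. f z = c} \<subseteq> {z \<in> ball 0 R. u z = 0 \<or> z \<in> {}}"
      using R by (auto simp: u_def)
    show "\<forall>z\<in>{z \<in> ball 0 R. u z = 0 \<or> z \<in> {}} - {z \<in> ball 0 r. f z = c}.
      winding_number g z * 1 * complex_of_int (zorder u z) = 0"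
    proof
      fix z assume "z\<in>{z \<in> ball 0 R. u z = 0 \<or> z \<in> {}} - {z \<in> ball 0 r. f z = c}"
      then have "r \<le> norm z" "norm z \<noteq> r" using unz by (auto simp: u_def)
      then have "winding_number g z = 0"
        using g by (intro winding_number_zero_outside[of g "cball 0 r"]) (auto simp: valid_path_imp_path)
      then show "winding_number g z * 1 * complex_of_int (zorder u z) = 0" by simp
    qed
  qed (auto simp: g_def winding_number_circlepath)
  also have "\<dots> = of_int N" by (simp add: N_def)
  finally have zeros: "contour_integral g (\<lambda>x. deriv u x / u x) = 2 * pi * \<i> * of_int N" by simp
  define Q where "Q = (\<lambda>z. u z / z ^ p)"
  have Qd: "(Q has_field_derivative deriv f z / z ^ p - of_nat p * Q z / z) (at z)"
    if "norm z < 1" "z \<noteq> 0" for z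
  proof -
    have zp: "z ^ p = z * z ^ (p - 1)" using p by (simp flip: power_Suc)
    have "((\<lambda>w. w ^ p) has_field_derivative of_nat p * z ^ (p - 1)) (at z)"
      by (auto intro!: derivative_eq_intros)
    from DERIV_divide[OF ud[OF that(1)] this] that(2)
    have "(Q has_field_derivative
      (deriv f z * z ^ p - u z * (of_nat p * z ^ (p - 1))) / (z ^ p * z ^ p)) (at z)"
      by (simp add: Q_def)
    also have "(deriv f z * z ^ p - u z * (of_nat p * z ^ (p - 1))) / (z ^ p * z ^ p)
        = deriv f z / z ^ p - of_nat p * Q z / z"
      using that(2) by (simp add: Q_def zp field_simps)
    finally show ?thesis .
  qed
  have open_A: "open (ball 0 R - {0::complex})" by (intro open_Diff) auto
  have "Q holomorphic_on ball 0 R - {0}"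
    unfolding Q_def by (intro holomorphic_intros holomorphic_on_subset[OF holu]) auto
  then have anQ: "Q analytic_on ball 0 R - {0}"
    using open_A by (simp add: analytic_on_open)
  have img: "path_image g \<subseteq> ball 0 R - {0}" using g R r by auto
  have vQ: "valid_path (Q \<circ> g)"
    by (rule valid_path_compose_analytic[OF g(1) anQ img])
  have nQ: "0 \<notin> path_image (Q \<circ> g)"
    using unz g r by (auto simp: path_image_compose Q_def)
  \<comment> \<open>Logarithmic derivative of \<open>Q\<close>: the zeros of \<open>u\<close> contribute \<open>N\<close>, the factor \<open>z\<^sup>p\<close> removes \<open>p\<close>.\<close>
  have "2 * pi * \<i> * winding_number (Q \<circ> g) 0 = contour_integral (Q \<circ> g) (\<lambda>w. 1 / (w - 0))"
    using has_contour_integral_winding_number[OF vQ nQ] by (simp add: contour_integral_unique)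
  also have "\<dots> = contour_integral g (\<lambda>w. deriv Q w * (1 / (Q w - 0)))"
    by (rule contour_integral_comp_analyticW[OF anQ g(1) img])
  also have "\<dots> = contour_integral g (\<lambda>w. deriv u w / u w - of_nat p * (1 / (w - 0)))"
  proof (rule contour_integral_eq)
    fix z assume "z \<in> path_image g"
    then have z: "norm z < 1" "z \<noteq> 0" "u z \<noteq> 0" using g r unz by auto
    then show "deriv Q z * (1 / (Q z - 0)) = deriv u z / u z - of_nat p * (1 / (z - 0))"
      using DERIV_imp_deriv[OF Qd[OF z(1,2)]] by (simp add: du Q_def field_simps)
  qed
  also have "\<dots> = contour_integral g (\<lambda>w. deriv u w / u w)
      - contour_integral g (\<lambda>w. of_nat p * (1 / (w - 0)))"
  proof (rule contour_integral_diff)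
    show "(\<lambda>w. deriv u w / u w) contour_integrable_on g"
    proof (rule contour_integrable_holomorphic_simple)
      show "open (ball 0 R - {z \<in> ball 0 R. u z = 0})"
        using fin by (intro open_Diff finite_imp_closed) auto
      show "(\<lambda>w. deriv u w / u w) holomorphic_on ball 0 R - {z \<in> ball 0 R. u z = 0}"
        using holu by (auto intro!: holomorphic_intros holomorphic_on_subset[OF holu]
          holomorphic_on_subset[OF holomorphic_deriv[OF holu]])
    qed (use g R unz in auto)
    show "(\<lambda>w. of_nat p * (1 / (w - 0))) contour_integrable_on g"
      using g r by (intro contour_integrable_lmul contour_integrable_inversediff) auto
  qed
  also have "contour_integral g (\<lambda>w. of_nat p * (1 / (w - 0))) = of_nat p * (2 * pi * \<i> * 1)"
    using has_contour_integral_winding_number[OF g(1), of 0] g r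
    by (intro contour_integral_unique has_contour_integral_lmul)
      (auto simp: g_def winding_number_circlepath_centre)
  finally have "2 * pi * \<i> * winding_number (Q \<circ> g) 0 = 2 * pi * \<i> * (of_int N - of_nat p)"
    by (simp add: zeros algebra_simps o_def)
  then have wn: "winding_number (Q \<circ> g) 0 = of_int N - of_nat p"
    by simp
  have "Re (winding_number (Q \<circ> g) 0) \<le> 0"
  proof (rule winding_number_le_0_if_cut_crossed_upwards)
    show "path (Q \<circ> g)" using vQ by (rule valid_path_imp_path)
    show "pathfinish (Q \<circ> g) = pathstart (Q \<circ> g)"
      using g by (simp add: pathfinish_compose pathstart_compose)
    show "0 \<notin> path_image (Q \<circ> g)" by fact
    fix t :: real assume t: "t \<in> {0..1}" "(Q \<circ> g) t \<in> \<real>\<^sub>\<le>\<^sub>0"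
    define z where "z = g t"
    have "z \<in> path_image g" using t by (auto simp: z_def path_image_def)
    then have z: "norm z < 1" "z \<noteq> 0" "u z \<noteq> 0" using g r unz by auto
    have "(g has_vector_derivative 2 * pi * \<i> * z) (at t within {0..1})"
      using has_vector_derivative_circlepath[of 0 r t "{0..1}"]
      by (simp add: g_def z_def circlepath mult_ac)
    then have "(Q \<circ> g has_vector_derivative 2 * pi * \<i> * z * (deriv f z / z ^ p - of_nat p * Q z / z))
        (at t within {0..1})"
      using Qd[OF z(1,2)] by (intro field_vector_diff_chain_within) (auto simp: z_def intro: has_field_derivative_at_within)
    also have "2 * pi * \<i> * z * (deriv f z / z ^ p - of_nat p * Q z / z) = 2 * pi * \<i> * (h z - of_nat p * Q z)"
    proof -
      have "z ^ p = z * z ^ (p - 1)" using p by (simp flip: power_Suc)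
      then show ?thesis using der[of z] z by (simp add: field_simps)
    qed
    finally have "((\<lambda>s. Im ((Q \<circ> g) s)) has_vector_derivative Im (2 * pi * \<i> * (h z - of_nat p * Q z)))
        (at t within {0..1})"
      by (rule bounded_linear.has_vector_derivative[OF bounded_linear_Im])
    moreover have "Im (2 * pi * \<i> * (h z - of_nat p * Q z)) = 2 * pi * (Re (h z) - real p * Re (Q z))"
      by simp
    moreover have "real p * Re (Q z) \<le> 0"
      using t by (auto simp: z_def complex_nonpos_Reals_iff mult_nonneg_nonpos)
    then have "2 * pi * (Re (h z) - real p * Re (Q z)) > 0"
      using pos[of z] z by (intro mult_pos_pos) auto
    ultimately show "\<exists>D>0. ((\<lambda>s. Im ((Q \<circ> g) s)) has_real_derivative D) (at t within {0..1})"
      unfolding has_real_derivative_iff_has_vector_derivative by metis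
  qed
  then have "N \<le> int p" by (simp add: wn)
  then show ?thesis by (simp add: N_def u_def)
qed

text \<open>Every finite part of a fibre is contained in a disc of radius \<open>r < 1\<close> whose boundary avoids the
  fibre, so the bound on such discs controls the whole fibre, and finiteness follows because every
  order is at least \<open>1\<close>. The value \<open>0\<close> is taken exactly \<open>p\<close> times, already at the origin.\<close>

lemma p_valent_of_Re_deriv_pos:
  fixes f g h :: "complex \<Rightarrow> complex"
  assumes holf: "f holomorphic_on ball 0 1" and p: "1 \<le> p"
    and der: "\<And>z. z \<in> ball 0 1 \<Longrightarrow> deriv f z = z ^ (p - 1) * h z"
    and pos: "\<And>z. z \<in> ball 0 1 \<Longrightarrow> Re (h z) > 0"
    and holg: "g holomorphic_on ball 0 1" and g0: "g 0 \<noteq> 0"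
    and fg: "\<And>z. z \<in> ball 0 1 \<Longrightarrow> f z = z ^ p * g z"
  shows "p_valent p f"
proof -
  define Z where "Z = (\<lambda>c. {z \<in> ball 0 1. f z = c})"
  have nconst: "\<not> (\<lambda>z. f z - c) constant_on ball 0 1" for c
    by (rule not_constant_of_Re_deriv_pos[OF der pos])
  have ord: "1 \<le> zorder (\<lambda>u. f u - c) z" if "z \<in> Z c" for z c
  proof -
    have "\<exists>w\<in>ball 0 1. f w - c \<noteq> 0"
      using nconst[of c] unfolding constant_on_def by metis
    moreover have "(\<lambda>u. f u - c) holomorphic_on ball 0 1"
      by (intro holomorphic_intros holf)
    ultimately have "0 < zorder (\<lambda>u. f u - c) z"
      using zorder_exist_zero[of "\<lambda>u. f u - c" "ball 0 1" z] that by (auto simp: Z_def)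
    then show ?thesis by simp
  qed
  have le: "(\<Sum>z \<in> T. zorder (\<lambda>u. f u - c) z) \<le> int p" if T: "finite T" "T \<subseteq> Z c" for T c
  proof -
    define R0 where "R0 = Max (insert 0 (norm ` T))"
    have R0: "0 \<le> R0" "\<And>z. z \<in> T \<Longrightarrow> norm z \<le> R0" "R0 < 1"
      using T by (auto simp: R0_def Z_def)
    define R where "R = (1 + R0) / 2"
    have R: "R0 < R" "R < 1" using R0 by (auto simp: R_def)
    have fin: "finite {z \<in> cball 0 R. f z - c = 0}"
      using R nconst by (intro holomorphic_compact_finite_zeros[of _ "ball 0 1"])
        (auto intro!: holomorphic_intros holf)
    have "infinite ({R0<..<R} - norm ` {z \<in> cball 0 R. f z - c = 0})"
      using R by (intro Diff_infinite_finite finite_imageI fin) auto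
    then obtain r where "r \<in> {R0<..<R} - norm ` {z \<in> cball 0 R. f z - c = 0}"
      by (metis finite.emptyI ex_in_conv)
    then have r: "R0 < r" "r < R" "\<And>z. norm z = r \<Longrightarrow> f z \<noteq> c" by auto
    have "(\<Sum>z \<in> T. zorder (\<lambda>u. f u - c) z) \<le> (\<Sum>z \<in> {z \<in> ball 0 r. f z = c}. zorder (\<lambda>u. f u - c) z)"
    proof (rule sum_mono2)
      show "finite {z \<in> ball 0 r. f z = c}"
        by (rule finite_subset[OF _ fin]) (use r in auto)
      show "T \<subseteq> {z \<in> ball 0 r. f z = c}" using T(2) R0(2) r by (fastforce simp: Z_def)
      show "0 \<le> zorder (\<lambda>u. f u - c) b" if "b \<in> {z \<in> ball 0 r. f z = c} - T" for b
        using ord[of b c] that r R by (auto simp: Z_def)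
    qed
    also have "\<dots> \<le> int p"
      by (rule sum_zorder_le_of_Re_deriv_pos[OF holf p der pos]) (use r R R0 in auto)
    finally show ?thesis .
  qed
  have fin: "finite (Z c)" for c
  proof (rule ccontr)
    assume "infinite (Z c)"
    then obtain T where T: "T \<subseteq> Z c" "finite T" "card T = Suc p"
      using infinite_arbitrarily_large by blast
    have "int (Suc p) = (\<Sum>z\<in>T. 1)" using T by simp
    also have "\<dots> \<le> (\<Sum>z \<in> T. zorder (\<lambda>u. f u - c) z)"
      using T ord by (intro sum_mono) auto
    also have "\<dots> \<le> int p" by (rule le) (use T in auto)
    finally show False by simp
  qed
  have "zorder (\<lambda>u. f u - 0) 0 = int p"
    by (rule zorder_eqI[of "ball 0 1" _ g]) (use holg g0 fg in \<open>auto simp: mult.commute\<close>)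
  moreover have "(\<Sum>z\<in>{0}. zorder (\<lambda>u. f u - 0) z) \<le> (\<Sum>z \<in> Z 0. zorder (\<lambda>u. f u - 0) z)"
  proof (rule sum_mono2)
    show "{0} \<subseteq> Z 0" using fg[of 0] p by (auto simp: Z_def)
    show "0 \<le> zorder (\<lambda>u. f u - 0) b" if "b \<in> Z 0 - {0}" for b
      using ord[of b 0] that by simp
  qed (rule fin)
  ultimately have eq: "(\<Sum>z \<in> Z 0. zorder (\<lambda>u. f u - 0) z) = int p"
    using le[OF fin order_refl, of 0] by simp
  then show ?thesis
    using fin le[OF fin order_refl] unfolding p_valent_def Z_def by (intro conjI allI exI[of _ 0]) simp_all
qed

section \<open>Power series estimates and a Moebius map\<close>

text \<open>The operator \<open>z d/dz\<close> multiplies the \<open>k\<close>-th coefficient by \<open>k\<close> and preserves convergence in the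
  open disc.\<close>

lemma summable_powser_power_weight:
  fixes c :: "nat \<Rightarrow> 'a :: {real_normed_field,banach}"
  assumes sm: "\<And>z. norm z < 1 \<Longrightarrow> summable (\<lambda>k. c k * z ^ k)" and z: "norm z < 1"
  shows "summable (\<lambda>k. of_nat k ^ N * c k * z ^ k)"
  using z
proof (induction N arbitrary: z)
  case (Suc N)
  define a where "a = (\<lambda>k. of_nat k ^ N * c k)"
  have "summable (\<lambda>k. diffs a k * z ^ k)"
    by (rule termdiff_converges[OF Suc.prems]) (use Suc.IH in \<open>auto simp: a_def\<close>)
  then have "summable (\<lambda>k. z * (diffs a k * z ^ k))"
    by (rule summable_mult)
  also have "(\<lambda>k. z * (diffs a k * z ^ k)) = (\<lambda>k. of_nat (Suc k) * a (Suc k) * z ^ Suc k)"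
    by (simp add: diffs_def mult_ac fun_eq_iff)
  finally have "summable (\<lambda>k. of_nat k * a k * z ^ k)"
    by (subst (asm) summable_Suc_iff)
  then show ?case by (simp add: a_def mult_ac)
qed (use sm in auto)

lemma summable_powser_weight:
  fixes c w :: "nat \<Rightarrow> real" and z :: complex
  assumes sm: "\<And>z :: complex. norm z < 1 \<Longrightarrow> summable (\<lambda>k. of_real (c k) * z ^ k)"
    and w: "\<And>k. m \<le> k \<Longrightarrow> \<bar>w k\<bar> \<le> C * real k ^ N" and z: "norm z < 1"
  shows "summable (\<lambda>k. of_real (w k * c k) * z ^ k)"
proof -
  define \<rho> where "\<rho> = (1 + norm z) / 2"
  have \<rho>: "norm z < \<rho>" "\<rho> < 1" "0 \<le> \<rho>"
    using z norm_ge_zero[of z] by (auto simp: \<rho>_def simp del: norm_ge_zero)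
  have "summable (\<lambda>k. of_nat k ^ N * of_real (c k) * (of_real \<rho> :: complex) ^ k)"
    by (rule summable_powser_power_weight[OF sm]) (use \<rho> in auto)
  from powser_insidea[OF this, of z] have "summable (\<lambda>k. norm (of_nat k ^ N * of_real (c k) * z ^ k))"
    using \<rho> by simp
  then have "summable (\<lambda>k. C * norm (of_nat k ^ N * of_real (c k) * z ^ k))"
    by (rule summable_mult)
  then show ?thesis
  proof (rule summable_comparison_test'[where N = m])
    fix k assume "m \<le> k"
    from w[OF this] have "\<bar>w k\<bar> * (\<bar>c k\<bar> * norm z ^ k) \<le> C * real k ^ N * (\<bar>c k\<bar> * norm z ^ k)"
      by (intro mult_right_mono) auto
    then show "norm (of_real (w k * c k) * z ^ k) \<le> C * norm (of_nat k ^ N * of_real (c k) * z ^ k)"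
      by (simp add: norm_mult norm_power abs_mult mult_ac)
  qed
qed

text \<open>The factor \<open>norm z\<close> comes from the vanishing constant term; it makes the bound strict inside the
  disc.\<close>

lemma norm_powser_le:
  fixes e :: "nat \<Rightarrow> real" and z :: complex
  assumes e: "\<And>j. 0 \<le> e j" "e 0 = 0" and bd: "\<And>N. (\<Sum>j<N. e j) \<le> X" and z: "norm z \<le> 1"
  shows "norm (\<Sum>j. of_real (e j) * z ^ j) \<le> norm z * X"
proof -
  have sm: "summable e"
    by (rule summableI_nonneg_bounded[OF e(1) bd])
  have le: "norm (of_real (e j) * z ^ j) \<le> norm z * e j" for j
  proof (cases j)
    case (Suc i)
    have "norm z ^ i \<le> 1" using z by (simp add: power_le_one)
    then have "e j * norm z * norm z ^ i \<le> e j * norm z * 1"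
      using e(1) by (intro mult_left_mono) auto
    then show ?thesis using e(1)[of j] by (simp add: Suc norm_mult norm_power mult_ac)
  qed (simp add: e)
  have "norm (\<Sum>j. of_real (e j) * z ^ j) \<le> (\<Sum>j. norm z * e j)"
    by (rule norm_suminf_le[OF le summable_mult[OF sm]])
  also have "\<dots> = norm z * (\<Sum>j. e j)" by (rule suminf_mult[OF sm])
  also have "\<dots> \<le> norm z * X"
    by (intro mult_left_mono suminf_le_const sm bd) auto
  finally show ?thesis .
qed

text \<open>With nonnegative coefficients, a bound on the sum for all \<open>r < 1\<close> passes to the coefficients at
  \<open>r = 1\<close> by letting \<open>r\<close> tend to \<open>1\<close> in each partial sum; no convergence at \<open>1\<close> is presupposed.\<close>

lemma sum_le_of_powser_le:
  fixes e :: "nat \<Rightarrow> real"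
  assumes e: "\<And>j. 0 \<le> e j"
    and sm: "\<And>r. 0 \<le> r \<Longrightarrow> r < 1 \<Longrightarrow> summable (\<lambda>j. e j * r ^ j)"
    and le: "\<And>r. 0 \<le> r \<Longrightarrow> r < 1 \<Longrightarrow> (\<Sum>j. e j * r ^ j) \<le> X"
  shows "(\<Sum>j<N. e j) \<le> X"
proof -
  have "((\<lambda>r::real. \<Sum>j<N. e j * r ^ j) \<longlongrightarrow> (\<Sum>j<N. e j * 1 ^ j)) (at_left 1)"
    by (intro tendsto_intros)
  moreover have "eventually (\<lambda>r::real. (\<Sum>j<N. e j * r ^ j) \<le> X) (at_left 1)"
    using eventually_at_left_real[OF zero_less_one]
  proof eventually_elim
    case (elim r)
    then have "(\<Sum>j<N. e j * r ^ j) \<le> (\<Sum>j. e j * r ^ j)"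
      using e by (intro sum_le_suminf sm) auto
    also have "\<dots> \<le> X" using elim by (intro le) auto
    finally show ?case .
  qed
  ultimately have "(\<Sum>j<N. e j * 1 ^ j) \<le> X"
    by (rule tendsto_upperbound) auto
  then show ?thesis by simp
qed

lemma sum_lessThan_shift_zeros:
  fixes a :: "nat \<Rightarrow> real"
  assumes "\<And>k. k < p \<Longrightarrow> a k = 0"
  shows "(\<Sum>k<N + p. a k) = (\<Sum>j<N. a (j + p))"
  using assms by (induction N) auto

lemma one_plus_mult_nonzero:
  assumes "\<bar>B\<bar> \<le> 1" and w: "norm w < 1"
  shows "1 + of_real B * w \<noteq> (0 :: complex)"
proof -
  have "\<bar>B\<bar> * norm w \<le> 1 * norm w" using assms(1) by (intro mult_right_mono) auto
  then have "norm (of_real B * w) < 1" using w by (simp add: norm_mult)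
  then show ?thesis by (metis add_eq_0_iff norm_minus_cancel norm_one less_irrefl)
qed

text \<open>The image of the unit disc under \<open>(1 + A w)/(1 + B w)\<close> is a disc or half-plane symmetric about
  the real axis, whose leftmost boundary point is the value at \<open>w = 1\<close>.\<close>

lemma Re_moebius_ge:
  fixes A B :: real and w :: complex
  assumes "-1 \<le> A" "A < B" "B \<le> 1" "0 < B" and w: "norm w < 1"
  shows "(1 + A) / (1 + B) \<le> Re ((1 + of_real A * w) / (1 + of_real B * w))"
proof -
  obtain x y where xy: "w = Complex x y" by (cases w)
  define s where "s = x\<^sup>2 + y\<^sup>2"
  have s: "s < 1" using w by (simp add: xy s_def cmod_def)
  have x: "x < 1" using complex_Re_le_cmod[of w] w by (simp add: xy)
  have "1 + of_real B * w \<noteq> 0"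
    using assms by (intro one_plus_mult_nonzero) auto
  moreover define D where "D = (1 + B * x)\<^sup>2 + (B * y)\<^sup>2"
  ultimately have D: "D > 0"
    unfolding D_def by (simp add: xy complex_eq_iff sum_power2_gt_zero_iff)
  have Re: "Re ((1 + of_real A * w) / (1 + of_real B * w)) = ((1 + A * x) * (1 + B * x) + A * y * (B * y)) / D"
    by (simp add: xy D_def Re_divide)
  \<comment> \<open>Clearing denominators in the claim leaves \<open>(B - A)\<close> times this expression.\<close>
  have "0 \<le> (1 - B) * (1 - x) + B * (1 - s)"
    using assms x s by (intro add_nonneg_nonneg mult_nonneg_nonneg) auto
  then have "0 \<le> (B - A) * ((1 - B) * (1 - x) + B * (1 - s))"
    using assms by simp
  also have "\<dots> = ((1 + A * x) * (1 + B * x) + A * y * (B * y)) * (1 + B) - (1 + A) * D"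
    by (simp add: s_def D_def power2_eq_square algebra_simps)
  finally have "(1 + A) * D \<le> ((1 + A * x) * (1 + B * x) + A * y * (B * y)) * (1 + B)"
    by simp
  then show ?thesis
    unfolding Re using D assms by (intro divide_le_eq[THEN iffD2]) (simp add: pos_le_divide_eq)
qed

section \<open>Functions with negative coefficients\<close>

text \<open>Coefficients are indexed by the actual exponent and set to \<open>0\<close> below \<open>n + p\<close>, so that they are
  unique and differentiation needs no index bookkeeping.\<close>

definition has_neg_coeffs :: "nat \<Rightarrow> nat \<Rightarrow> (nat \<Rightarrow> real) \<Rightarrow> (complex \<Rightarrow> complex) \<Rightarrow> bool" where
  "has_neg_coeffs n p c f \<longleftrightarrow> (\<forall>k. 0 \<le> c k) \<and> (\<forall>k<n + p. c k = 0) \<and>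
     (\<forall>z\<in>unit_disc. (\<lambda>k. of_real (c k) * z ^ k) sums (z ^ p - f z))"

lemma has_neg_coeffsD:
  assumes "has_neg_coeffs n p c f"
  shows "0 \<le> c k" "k < n + p \<Longrightarrow> c k = 0"
    "norm z < 1 \<Longrightarrow> (\<lambda>k. of_real (c k) * z ^ k) sums (z ^ p - f z)"
  using assms by (auto simp: has_neg_coeffs_def)

lemma has_neg_coeffs_shifted_sums:
  assumes "has_neg_coeffs n p c f" "norm z < 1"
  shows "(\<lambda>k. of_real (c (n + p + k)) * z ^ (n + p + k)) sums (z ^ p - f z)"
proof -
  have "(\<lambda>k. of_real (c (k + (n + p))) * z ^ (k + (n + p))) sums (z ^ p - f z)"
    by (subst sums_zero_iff_shift) (use has_neg_coeffsD[OF assms(1)] assms(2) in auto)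
  then show ?thesis by (simp add: add_ac)
qed

lemma has_neg_coeffs_of_shifted_sums:
  assumes "\<And>k. 0 \<le> c (n + p + k)"
    and "\<And>z. norm z < 1 \<Longrightarrow> (\<lambda>k. of_real (c (n + p + k)) * z ^ (n + p + k)) sums (z ^ p - f z)"
  shows "has_neg_coeffs n p (\<lambda>k. if k < n + p then 0 else c k) f"
  unfolding has_neg_coeffs_def
proof (intro conjI allI ballI impI)
  fix k show "0 \<le> (if k < n + p then 0 else c k)"
    using assms(1)[of "k - (n + p)"] by auto
next
  fix z :: complex assume "z \<in> unit_disc"
  then have "(\<lambda>k. of_real (if k + (n + p) < n + p then 0 else c (k + (n + p))) * z ^ (k + (n + p)))
      sums (z ^ p - f z)"
    using assms(2)[of z] by (simp add: add_ac)
  then show "(\<lambda>k. of_real (if k < n + p then 0 else c k) * z ^ k) sums (z ^ p - f z)"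
    by (subst (asm) sums_zero_iff_shift) auto
qed auto

lemma has_neg_coeffs_sums:
  assumes "has_neg_coeffs n p c f" "norm z < 1"
  shows "(\<lambda>k. ((if k = p then 1 else 0) - of_real (c k)) * z ^ k) sums f z"
proof -
  have "(\<lambda>k. if k = p then z ^ k else 0) sums z ^ p" by (rule sums_single)
  from sums_diff[OF this has_neg_coeffsD(3)[OF assms]] show ?thesis
    by (simp add: left_diff_distrib if_distrib[of "\<lambda>x. x * _"] cong: if_cong)
qed

lemma has_neg_coeffs_holomorphic:
  assumes "has_neg_coeffs n p c f"
  shows "f holomorphic_on unit_disc"
  by (rule power_series_holomorphic[where a = "\<lambda>k. (if k = p then 1 else 0) - of_real (c k)"])
    (use has_neg_coeffs_sums[OF assms] in auto)

lemma has_neg_coeffs_fps_nth: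
  assumes "has_neg_coeffs n p c f"
  shows "fps_nth (fps_expansion f 0) k = (if k = p then 1 else 0) - of_real (c k)"
proof -
  define G :: "complex fps" where "G = Abs_fps (\<lambda>k. (if k = p then 1 else 0) - of_real (c k))"
  have sums: "(\<lambda>k. fps_nth G k * z ^ k) sums f z" if "norm z < 1" for z
    using has_neg_coeffs_sums[OF assms that] by (simp add: G_def)
  have "norm (1/2 :: complex) \<le> conv_radius (fps_nth G)"
    using sums[of "1/2"] by (intro conv_radius_geI) (auto simp: sums_iff)
  then have "fps_conv_radius G > 0"
    unfolding fps_conv_radius_def by (rule less_le_trans[rotated]) auto
  moreover have "eventually (\<lambda>z. eval_fps G z = f z) (nhds 0)"
    by (rule eventually_mono[OF eventually_nhds_in_open[of "ball 0 1"]])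
      (use sums in \<open>auto simp: eval_fps_def sums_iff\<close>)
  ultimately have "f has_fps_expansion G" by (simp add: has_fps_expansion_def)
  then show ?thesis by (simp add: fps_expansion_eqI G_def)
qed

text \<open>The power series of \<open>f'(z)/z\<^bsup>p-1\<^esup>\<close> when \<open>f\<close> has negative coefficients \<open>c\<close>; unlike the
  quotient itself it is analytic at \<open>0\<close>.\<close>

definition deriv_quotient :: "nat \<Rightarrow> (nat \<Rightarrow> real) \<Rightarrow> complex \<Rightarrow> complex" where
  "deriv_quotient p c z = of_nat p - (\<Sum>j. of_real (real (j + p) * c (j + p)) * z ^ j)"

lemma deriv_quotient_summable:
  fixes z :: complex
  assumes "has_neg_coeffs n p c f" "norm z < 1"
  shows "summable (\<lambda>j. of_real (real (j + p) * c (j + p)) * z ^ j)"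
proof (cases "z = 0")
  case False
  have "summable (\<lambda>k. of_real (real k * c k) * z ^ k)"
    using has_neg_coeffsD(3)[OF assms(1)] assms(2)
    by (intro summable_powser_weight[where m = 0 and C = 1 and N = 1]) (auto simp: sums_iff)
  then have "summable (\<lambda>j. of_real (real (j + p) * c (j + p)) * z ^ (j + p))"
    by (subst summable_iff_shift)
  then have "summable (\<lambda>j. of_real (real (j + p) * c (j + p)) * z ^ (j + p) * (1 / z ^ p))"
    by (rule summable_mult2)
  then show ?thesis using False by (simp add: power_add mult.assoc)
qed simp

lemma deriv_quotient_holomorphic:
  assumes "has_neg_coeffs n p c f"
  shows "deriv_quotient p c holomorphic_on unit_disc"
proof -
  have "(\<lambda>z. \<Sum>j. of_real (real (j + p) * c (j + p)) * z ^ j) holomorphic_on ball (0 :: complex) 1"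
    by (rule power_series_holomorphic[where a = "\<lambda>j. of_real (real (j + p) * c (j + p))"])
      (use deriv_quotient_summable[OF assms] in \<open>auto intro!: summable_sums\<close>)
  then show ?thesis
    unfolding deriv_quotient_def by (intro holomorphic_intros)
qed

lemma has_neg_coeffs_deriv:
  assumes f: "has_neg_coeffs n p c f" and p: "1 \<le> p" and n: "1 \<le> n" and z: "norm z < 1"
  shows "deriv f z = z ^ (p - 1) * deriv_quotient p c z"
proof -
  define b :: "nat \<Rightarrow> complex" where "b = (\<lambda>k. of_real (c k))"
  have sums: "(\<lambda>k. b k * x ^ k) sums (x ^ p - f x)" if "norm x < 1" for x
    using has_neg_coeffsD(3)[OF f that] by (simp add: b_def)
  have "((\<lambda>x. \<Sum>k. b k * x ^ k) has_field_derivative (\<Sum>k. diffs b k * z ^ k)) (at z)"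
    by (rule termdiffs_strong'[OF _ z]) (use sums in \<open>auto simp: sums_iff\<close>)
  then have "((\<lambda>x. x ^ p - (\<Sum>k. b k * x ^ k)) has_field_derivative
      of_nat p * z ^ (p - 1) - (\<Sum>k. diffs b k * z ^ k)) (at z)"
    by (auto intro!: derivative_eq_intros)
  then have "(f has_field_derivative of_nat p * z ^ (p - 1) - (\<Sum>k. diffs b k * z ^ k)) (at z)"
    by (rule has_field_derivative_transform_within_open[of _ _ _ "ball 0 1"])
      (use z sums in \<open>auto simp: sums_iff\<close>)
  then have *: "deriv f z = of_nat p * z ^ (p - 1) - (\<Sum>k. diffs b k * z ^ k)"
    by (rule DERIV_imp_deriv)
  have "(\<lambda>j. z ^ (p - 1) * (of_real (real (j + p) * c (j + p)) * z ^ j)) sums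
      (z ^ (p - 1) * (\<Sum>j. of_real (real (j + p) * c (j + p)) * z ^ j))"
    by (intro sums_mult summable_sums deriv_quotient_summable[OF f z])
  also have "(\<lambda>j. z ^ (p - 1) * (of_real (real (j + p) * c (j + p)) * z ^ j))
      = (\<lambda>j. diffs b (j + (p - 1)) * z ^ (j + (p - 1)))"
  proof
    fix j
    have "Suc (j + (p - 1)) = j + p" using p by simp
    then show "z ^ (p - 1) * (of_real (real (j + p) * c (j + p)) * z ^ j)
        = diffs b (j + (p - 1)) * z ^ (j + (p - 1))"
      by (simp only: diffs_def b_def power_add) (simp add: mult_ac)
  qed
  finally have "(\<lambda>k. diffs b k * z ^ k) sums
      (z ^ (p - 1) * (\<Sum>j. of_real (real (j + p) * c (j + p)) * z ^ j))"
    by (subst (asm) sums_zero_iff_shift) (use n has_neg_coeffsD(2)[OF f] in \<open>auto simp: diffs_def b_def\<close>)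
  then show ?thesis
    by (simp add: * deriv_quotient_def sums_iff algebra_simps)
qed

lemma remove_sings_deriv_quotient:
  assumes f: "has_neg_coeffs n p c f" and p: "1 \<le> p" and n: "1 \<le> n" and z: "norm z < 1"
  shows "remove_sings (\<lambda>u. deriv f u / u ^ (p - 1)) z = deriv_quotient p c z"
proof (rule remove_sings_eqI)
  have "isCont (deriv_quotient p c) z"
    using z by (intro continuous_on_interior[OF holomorphic_on_imp_continuous_on[OF
      deriv_quotient_holomorphic[OF f]]]) auto
  then have "deriv_quotient p c \<midarrow>z\<rightarrow> deriv_quotient p c z" by (simp add: isCont_def)
  moreover have "eventually (\<lambda>u. deriv_quotient p c u = deriv f u / u ^ (p - 1)) (at z)"
  proof -
    have "eventually (\<lambda>u. u \<in> ball 0 1 - {0}) (at z)"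
      using z eventually_at_in_open[of "ball 0 1" z] eventually_neq_at_within[of 0 z UNIV]
      by (auto elim: eventually_elim2)
    then show ?thesis
      by eventually_elim (use has_neg_coeffs_deriv[OF f p n] in auto)
  qed
  ultimately show "(\<lambda>u. deriv f u / u ^ (p - 1)) \<midarrow>z\<rightarrow> deriv_quotient p c z"
    by (rule Lim_transform_eventually)
qed

text \<open>The coefficient bound makes \<open>f'(z)/z\<^bsup>p-1\<^esup>\<close> differ from \<open>p\<close> by less than \<open>p\<close>, so its real part is
  positive.\<close>

lemma has_neg_coeffs_p_valent:
  assumes f: "has_neg_coeffs n p c f" and p: "1 \<le> p" and n: "1 \<le> n"
    and bd: "\<And>N. (\<Sum>k<N. real k * c k) \<le> real p"
  shows "p_valent p f"
proof (rule p_valent_of_Re_deriv_pos)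
  note c = has_neg_coeffsD[OF f]
  show "f holomorphic_on unit_disc" by (rule has_neg_coeffs_holomorphic[OF f])
  show "1 \<le> p" by fact
  show "deriv f z = z ^ (p - 1) * deriv_quotient p c z" if "z \<in> unit_disc" for z
    using has_neg_coeffs_deriv[OF f p n] that by simp
  show "Re (deriv_quotient p c z) > 0" if "z \<in> unit_disc" for z
  proof -
    have "(\<Sum>j<N. real (j + p) * c (j + p)) \<le> real p" for N
      using bd[of "N + p"] c(2) by (subst (asm) sum_lessThan_shift_zeros) auto
    then have "norm (\<Sum>j. of_real (real (j + p) * c (j + p)) * z ^ j) \<le> norm z * real p"
      using c n that by (intro norm_powser_le) auto
    also have "\<dots> < real p" using that p by simp
    finally have "Re (\<Sum>j. of_real (real (j + p) * c (j + p)) * z ^ j) < real p"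
      using complex_Re_le_cmod le_less_trans by blast
    then show ?thesis by (simp add: deriv_quotient_def)
  qed
  define a where "a = (\<lambda>k. (if k = p then 1 else 0) - complex_of_real (c k))"
  define g where "g = (\<lambda>z. \<Sum>j. a (j + p) * z ^ j)"
  have sm: "(\<lambda>j. a (j + p) * z ^ (j + p)) sums f z" if "norm z < 1" for z
    using has_neg_coeffs_sums[OF f that] c(2)
    by (subst sums_zero_iff_shift) (auto simp: a_def)
  have sg: "(\<lambda>j. a (j + p) * z ^ j) sums g z" if "norm z < 1" for z
  proof -
    have "summable (\<lambda>j. a (j + p) * z ^ j)"
    proof (cases "z = 0")
      case False
      have "summable (\<lambda>j. a (j + p) * z ^ (j + p) * (1 / z ^ p))"
        using sm[OF that] by (intro summable_mult2) (auto simp: sums_iff)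
      then show ?thesis using False by (simp add: power_add mult.assoc)
    qed simp
    then show ?thesis unfolding g_def by (rule summable_sums)
  qed
  show "g holomorphic_on unit_disc"
    by (rule power_series_holomorphic[where a = "\<lambda>j. a (j + p)"]) (use sg in auto)
  have "g 0 = a p" by (simp add: g_def)
  then show "g 0 \<noteq> 0" using c(2)[of p] n by (simp add: a_def)
  show "f z = z ^ p * g z" if "z \<in> unit_disc" for z
  proof (rule sums_unique2)
    show "(\<lambda>j. a (j + p) * z ^ (j + p)) sums f z" using sm that by simp
    have "(\<lambda>j. z ^ p * (a (j + p) * z ^ j)) sums (z ^ p * g z)"
      using sg that by (intro sums_mult) simp
    then show "(\<lambda>j. a (j + p) * z ^ (j + p)) sums (z ^ p * g z)"
      by (simp add: power_add mult_ac)
  qed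
qed

section \<open>The multipliers and the operator\<close>

locale quasi_convolution =
  fixes n p :: nat and \<delta> lam \<mu> l A B :: real
  assumes n: "1 \<le> n" and p: "1 \<le> p"
    and lam: "\<mu> \<le> lam" and mu: "0 \<le> \<mu>" and l: "0 \<le> l" and delta: "0 \<le> \<delta>"
    and A: "-1 \<le> A" and AB: "A < B" and B1: "B \<le> 1" and B0: "0 < B"
begin

abbreviation \<Phi> :: "nat \<Rightarrow> real" where "\<Phi> \<equiv> Phi p \<delta> lam \<mu> l"

abbreviation base :: "nat \<Rightarrow> real" where
  "base k \<equiv> ((real k - real p) * (lam * \<mu> * real k + lam - \<mu>) + real p + l) / (real p + l)"

lemma base_mono:
  assumes "p \<le> j" "j \<le> k"
  shows "1 \<le> base j" "base j \<le> base k"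
proof -
  have pl: "real p + l > 0" using p l by simp
  have s: "0 \<le> lam * \<mu> * real j + lam - \<mu>"
    using lam mu by (smt (verit) mult_nonneg_nonneg of_nat_0_le_iff)
  have "lam * \<mu> * real j \<le> lam * \<mu> * real k"
    using assms lam mu by (intro mult_left_mono) auto
  then have "(real j - real p) * (lam * \<mu> * real j + lam - \<mu>) \<le> (real k - real p) * (lam * \<mu> * real k + lam - \<mu>)"
    using assms s by (intro mult_mono) auto
  then show "base j \<le> base k" using pl by (intro divide_right_mono) auto
  have "0 \<le> (real j - real p) * (lam * \<mu> * real j + lam - \<mu>)"
    using assms s by (intro mult_nonneg_nonneg) auto
  then show "1 \<le> base j" using pl by simp
qed

lemma Phi_ge_1: "p \<le> k \<Longrightarrow> 1 \<le> \<Phi> k"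
  using base_mono(1)[of k k] delta by (simp add: Phi_def ge_one_powr_ge_zero)

lemma Phi_mono: "p \<le> j \<Longrightarrow> j \<le> k \<Longrightarrow> \<Phi> j \<le> \<Phi> k"
  unfolding Phi_def using base_mono[of j k] delta by (intro powr_mono2) linarith+

text \<open>Polynomial growth of the multipliers ensures that the series of \<open>J_op\<close> converges in the whole
  disc.\<close>

lemma Phi_poly_bound: "\<exists>C N. \<forall>k\<ge>p. \<bar>\<Phi> k\<bar> \<le> C * real k ^ N"
proof -
  define D where "D = (lam * \<mu> + lam + real p + l) / (real p + l)"
  define M where "M = nat \<lceil>\<delta>\<rceil>"
  have "\<bar>\<Phi> k\<bar> \<le> D ^ M * real k ^ (2 * M)" if k: "p \<le> k" for k
  proof -
    have pl: "real p + l > 0" using p l by simp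
    have k1: "1 \<le> real k" using p k by simp
    have k2: "1 \<le> (real k)\<^sup>2" using k1 by simp
    have lm: "0 \<le> lam * \<mu>" "0 \<le> lam" using lam mu by auto
    have "lam * 1 \<le> lam * real k" using k1 lm by (intro mult_left_mono) auto
    then have "lam * \<mu> * real k + lam - \<mu> \<le> (lam * \<mu> + lam) * real k"
      using mu by (simp add: distrib_right)
    moreover have "0 \<le> lam * \<mu> * real k + lam - \<mu>"
      using lam lm by (smt (verit) mult_nonneg_nonneg of_nat_0_le_iff)
    ultimately have "(real k - real p) * (lam * \<mu> * real k + lam - \<mu>) \<le> real k * ((lam * \<mu> + lam) * real k)"
      using k by (intro mult_mono) auto
    moreover have "(real p + l) * 1 \<le> (real p + l) * (real k)\<^sup>2"
      using pl k2 by (intro mult_left_mono) auto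
    ultimately have "base k \<le> D * (real k)\<^sup>2"
      using pl by (simp add: D_def divide_right_mono power2_eq_square algebra_simps)
    moreover have b1: "1 \<le> base k" using base_mono(1)[of k k] k by simp
    ultimately have b2: "base k \<le> D * (real k)\<^sup>2" "1 \<le> base k" by blast+
    then have b3: "1 \<le> D * (real k)\<^sup>2" by linarith
    have "base k powr \<delta> \<le> (D * (real k)\<^sup>2) powr \<delta>"
      using delta b2 by (intro powr_mono2) linarith+
    also have "(D * (real k)\<^sup>2) powr \<delta> \<le> (D * (real k)\<^sup>2) powr real M"
      using b3 by (intro powr_mono) (auto simp: M_def real_nat_ceiling_ge)
    also have "\<dots> = (D * (real k)\<^sup>2) ^ M" using b3 by (intro powr_realpow) auto
    finally show ?thesis by (simp add: Phi_def power_mult_distrib power_mult)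
  qed
  then show ?thesis by blast
qed

lemma J_op_has_neg_coeffs:
  assumes f: "has_neg_coeffs n p c f"
  shows "has_neg_coeffs n p (\<lambda>k. \<Phi> k * c k) (J_op n p \<delta> lam \<mu> l f)"
proof -
  note c = has_neg_coeffsD[OF f]
  obtain C N where CN: "\<And>k. p \<le> k \<Longrightarrow> \<bar>\<Phi> k\<bar> \<le> C * real k ^ N" using Phi_poly_bound by blast
  show ?thesis
    unfolding has_neg_coeffs_def
  proof (intro conjI allI ballI impI)
    show "0 \<le> \<Phi> k * c k" for k using c(1) by (simp add: Phi_def)
    show "\<Phi> k * c k = 0" if "k < n + p" for k using c(2)[OF that] by simp
    fix z :: complex assume "z \<in> unit_disc"
    then have z: "norm z < 1" by simp
    have "summable (\<lambda>k. of_real (\<Phi> k * c k) * z ^ k)"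
      by (rule summable_powser_weight[OF _ CN z]) (use c(3) in \<open>auto simp: sums_iff\<close>)
    then have s: "(\<lambda>k. of_real (\<Phi> k * c k) * z ^ k) sums (\<Sum>k. of_real (\<Phi> k * c k) * z ^ k)" (is "_ sums ?S")
      by (rule summable_sums)
    then have "(\<lambda>k. of_real (\<Phi> (k + (n + p)) * c (k + (n + p))) * z ^ (k + (n + p))) sums ?S"
      by (subst sums_zero_iff_shift) (use c in auto)
    then have "(\<lambda>k. - (of_real (\<Phi> (n + p + k) * c (n + p + k)) * z ^ (n + p + k))) sums - ?S"
      by (intro sums_minus) (simp add: add_ac)
    moreover have "(\<lambda>k. - (of_real (\<Phi> (n + p + k) * c (n + p + k)) * z ^ (n + p + k)))
      = (\<lambda>k. of_real (\<Phi> (n + p + k)) * fps_nth (fps_expansion f 0) (n + p + k) * z ^ (n + p + k))"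
      using n by (simp add: has_neg_coeffs_fps_nth[OF f])
    ultimately have "J_op n p \<delta> lam \<mu> l f z = z ^ p - ?S"
      by (simp add: J_op_def sums_iff)
    with s show "(\<lambda>k. of_real (\<Phi> k * c k) * z ^ k) sums (z ^ p - J_op n p \<delta> lam \<mu> l f z)" by simp
  qed
qed

section \<open>The coefficient characterisation of the class\<close>

text \<open>Since the terms are nonnegative, bounding all partial sums expresses both the convergence of the
  series and the bound on its sum.\<close>

definition coeff_bound :: "(nat \<Rightarrow> real) \<Rightarrow> real \<Rightarrow> bool" where
  "coeff_bound c X \<longleftrightarrow> (\<forall>N. (\<Sum>k<N. real k * (1 + B) * \<Phi> k * c k) \<le> X)"

text \<open>On the segment \<open>[0, 1)\<close> the subordinate function is real and equal to
  \<open>1 - S(r)/(p - \<sigma>)\<close> with \<open>S\<close> increasing, while subordination keeps it above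
  \<open>(1 + A)/(1 + B)\<close>. Letting \<open>r\<close> tend to \<open>1\<close> bounds the coefficients.\<close>

lemma class_P_neg_imp_coeff_bound:
  assumes f: "f \<in> class_P_neg n p \<delta> lam \<mu> l A B \<sigma>" and \<sigma>: "\<sigma> < real p"
  obtains c where "has_neg_coeffs n p c f" "coeff_bound c ((B - A) * (real p - \<sigma>))"
proof -
  from f obtain a :: "nat \<Rightarrow> complex" where
    "\<forall>z\<in>unit_disc. (\<lambda>k. of_real (norm (a (n + p + k))) * z ^ (n + p + k)) sums (z ^ p - f z)"
    unfolding class_P_neg_def by blast
  then have "\<And>z. norm z < 1 \<Longrightarrow> (\<lambda>k. of_real (norm (a (n + p + k))) * z ^ (n + p + k)) sums (z ^ p - f z)"
    by simp
  from has_neg_coeffs_of_shifted_sums[of "\<lambda>k. norm (a k)", OF _ this]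
  obtain c where c: "has_neg_coeffs n p c f" by auto
  note cD = has_neg_coeffsD[OF c]
  define e where "e = (\<lambda>j. real (j + p) * (\<Phi> (j + p) * c (j + p)))"
  note J = J_op_has_neg_coeffs[OF c]
  from f obtain w where "\<forall>z\<in>unit_disc. norm (w z) < 1 \<and> 1 / of_real (real p - \<sigma>) *
       (remove_sings (\<lambda>u. deriv (J_op n p \<delta> lam \<mu> l f) u / u ^ (p - 1)) z - of_real \<sigma>)
       = (1 + of_real A * w z) / (1 + of_real B * w z)"
    unfolding class_P_neg_def class_P_def subordinate_def mem_Collect_eq by blast
  then have w: "\<And>z. norm z < 1 \<Longrightarrow> norm (w z) < 1"
    "\<And>z. norm z < 1 \<Longrightarrow> 1 / of_real (real p - \<sigma>) *
       (remove_sings (\<lambda>u. deriv (J_op n p \<delta> lam \<mu> l f) u / u ^ (p - 1)) z - of_real \<sigma>)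
       = (1 + of_real A * w z) / (1 + of_real B * w z)"
    by simp_all
  have sm: "summable (\<lambda>j. e j * r ^ j)" if "0 \<le> r" "r < 1" for r
  proof -
    have "summable (\<lambda>j. complex_of_real (e j) * of_real r ^ j)"
      using deriv_quotient_summable[OF J, of "of_real r"] that by (simp add: e_def)
    then have "summable (\<lambda>j. complex_of_real (e j * r ^ j))"
      by (simp only: of_real_mult of_real_power)
    then show ?thesis by (simp only: summable_complex_of_real)
  qed
  have "(\<Sum>j<N. e j) \<le> (B - A) * (real p - \<sigma>) / (1 + B)" for N
  proof (rule sum_le_of_powser_le[OF _ sm])
    show "0 \<le> e j" for j using cD(1) by (simp add: e_def Phi_def)
    fix r :: real assume r: "0 \<le> r" "r < 1"
    define S where "S = (\<Sum>j. e j * r ^ j)"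
    have "(\<Sum>j. of_real (e j) * of_real r ^ j) = complex_of_real S"
      unfolding S_def using suminf_of_real[OF sm[OF r], where 'a = complex] by simp
    then have "deriv_quotient p (\<lambda>k. \<Phi> k * c k) (of_real r) = of_real (real p - S)"
      by (simp add: deriv_quotient_def e_def)
    then have "of_real ((real p - S - \<sigma>) / (real p - \<sigma>))
        = (1 + of_real A * w (of_real r)) / (1 + of_real B * w (of_real r))"
      using w(2)[of "of_real r"] r remove_sings_deriv_quotient[OF J p n, of "of_real r"] by simp
    then have "(1 + A) / (1 + B) \<le> (real p - S - \<sigma>) / (real p - \<sigma>)"
      using Re_moebius_ge[OF A AB B1 B0 w(1)[of "of_real r"]] r by (metis Re_complex_of_real abs_of_nonneg norm_of_real)
    then show "S \<le> (B - A) * (real p - \<sigma>) / (1 + B)"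
      using \<sigma> B0 by (simp add: field_simps)
  qed
  then have e: "(1 + B) * (\<Sum>j<N. e j) \<le> (B - A) * (real p - \<sigma>)" for N
    using B0 by (simp add: field_simps)
  have "coeff_bound c ((B - A) * (real p - \<sigma>))"
    unfolding coeff_bound_def
  proof
    fix N
    have "(\<Sum>k<N. real k * (1 + B) * \<Phi> k * c k) \<le> (\<Sum>k<N + p. real k * (1 + B) * \<Phi> k * c k)"
      using cD(1) B0 by (intro sum_mono2) (auto simp: Phi_def)
    also have "\<dots> = (1 + B) * (\<Sum>j<N. e j)"
      by (subst sum_lessThan_shift_zeros) (use cD(2) in \<open>auto simp: e_def sum_distrib_left mult_ac\<close>)
    also note e
    finally show "(\<Sum>k<N. real k * (1 + B) * \<Phi> k * c k) \<le> (B - A) * (real p - \<sigma>)" .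
  qed
  with c that show ?thesis by blast
qed

text \<open>Solving \<open>1 - s = (1 + A w)/(1 + B w)\<close> for \<open>w\<close> gives the only possible subordinating function
  \<open>w = s/(B - A - B s)\<close>. The coefficient bound yields \<open>norm s < (B - A)/(1 + B)\<close>, which is
  what is needed for \<open>norm w < 1\<close>. The same bound gives \<open>\<Sum> k c\<^sub>k \<le> p\<close>, hence p-valence.\<close>

lemma coeff_bound_imp_class_P_neg:
  assumes f: "has_neg_coeffs n p c f" and bd: "coeff_bound c ((B - A) * (real p - \<sigma>))"
    and \<sigma>: "0 \<le> \<sigma>" "\<sigma> < real p"
  shows "f \<in> class_P_neg n p \<delta> lam \<mu> l A B \<sigma>"
proof -
  note c = has_neg_coeffsD[OF f]
  note J = J_op_has_neg_coeffs[OF f]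
  define X where "X = (B - A) * (real p - \<sigma>) / (1 + B)"
  have bd': "(\<Sum>k<N. real k * (\<Phi> k * c k)) \<le> X" for N
  proof -
    have "(1 + B) * (\<Sum>k<N. real k * (\<Phi> k * c k)) \<le> (B - A) * (real p - \<sigma>)"
      using bd unfolding coeff_bound_def by (simp add: sum_distrib_left mult_ac)
    then show ?thesis using B0 by (simp add: X_def field_simps)
  qed
  have "(B - A) * (real p - \<sigma>) \<le> (1 + B) * real p"
    using A AB \<sigma> by (intro mult_mono) auto
  then have Xp: "X \<le> real p" using B0 by (simp add: X_def field_simps)
  have "(\<Sum>k<N. real k * c k) \<le> real p" for N
  proof -
    have "real k * c k \<le> real k * (\<Phi> k * c k)" for k
    proof (cases "k < n + p")
      case False
      then have "1 * c k \<le> \<Phi> k * c k" using Phi_ge_1[of k] c(1) by (intro mult_right_mono) auto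
      then show ?thesis by (intro mult_left_mono) auto
    qed (simp add: c)
    then have "(\<Sum>k<N. real k * c k) \<le> (\<Sum>k<N. real k * (\<Phi> k * c k))" by (intro sum_mono)
    with bd'[of N] Xp show ?thesis by linarith
  qed
  then have pv: "p_valent p f" by (rule has_neg_coeffs_p_valent[OF f p n])
  have shifted: "(\<lambda>k. of_real (c (n + p + k)) * z ^ (n + p + k)) sums (z ^ p - f z)" if "norm z < 1" for z :: complex
    by (rule has_neg_coeffs_shifted_sums[OF f that])
  have "(\<lambda>k. complex_of_real (- c (n + p + k)) * z ^ (n + p + k)) sums (f z - z ^ p)" if "norm z < 1" for z
    using sums_minus[OF shifted[OF that]] by simp
  then have cA: "f \<in> class_A n p"
    using pv has_neg_coeffs_holomorphic[OF f]
    by (auto simp: class_A_def intro!: exI[of _ "\<lambda>k. complex_of_real (- c k)"])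
  define s where "s = (\<lambda>z. (of_nat p - deriv_quotient p (\<lambda>k. \<Phi> k * c k) z) / of_real (real p - \<sigma>))"
  define w where "w = (\<lambda>z. s z / (of_real (B - A) - of_real B * s z))"
  define E where "E = (\<lambda>z. 1 / of_real (real p - \<sigma>) *
       (remove_sings (\<lambda>u. deriv (J_op n p \<delta> lam \<mu> l f) u / u ^ (p - 1)) z - of_real \<sigma>))"
  have pc: "complex_of_real (real p - \<sigma>) \<noteq> 0" using \<sigma> by (simp only: of_real_eq_0_iff)
  have E: "E z = 1 - s z" if "norm z < 1" for z
    using remove_sings_deriv_quotient[OF J p n that] pc
    by (simp add: E_def s_def divide_simps)
  have s_le: "norm (s z) \<le> norm z * ((B - A) / (1 + B))" if "norm z < 1" for z
  proof -
    have "(\<Sum>j<N. real (j + p) * (\<Phi> (j + p) * c (j + p))) \<le> X" for N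
      using bd'[of "N + p"] c(2) by (subst (asm) sum_lessThan_shift_zeros) auto
    then have "norm (\<Sum>j. of_real (real (j + p) * (\<Phi> (j + p) * c (j + p))) * z ^ j) \<le> norm z * X"
      using c n that by (intro norm_powser_le) (auto simp: Phi_def)
    then have "norm (s z) \<le> norm z * X / (real p - \<sigma>)"
      using \<sigma> by (simp add: s_def deriv_quotient_def norm_divide divide_right_mono del: of_real_diff)
    then show ?thesis using \<sigma> by (simp add: X_def)
  qed
  have s_lt: "norm (s z) < (B - A) / (1 + B)" if "norm z < 1" for z
  proof -
    have "norm z * ((B - A) / (1 + B)) < 1 * ((B - A) / (1 + B))"
      using that AB B0 by (intro mult_strict_right_mono) auto
    with s_le[OF that] show ?thesis by simp
  qed
  have den: "norm (s z) < norm (of_real (B - A) - of_real B * s z)" if "norm z < 1" for z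
  proof -
    have "B * norm (s z) \<le> B * ((B - A) / (1 + B))"
      using s_lt[OF that] B0 by (intro mult_left_mono) auto
    moreover have "(B - A) - B * ((B - A) / (1 + B)) = (B - A) / (1 + B)"
      using B0 by (simp add: field_simps)
    moreover have "(B - A) - B * norm (s z) \<le> norm (of_real (B - A) - of_real B * s z)"
      using norm_triangle_ineq2[of "of_real (B - A)" "of_real B * s z"] AB B0
      by (simp add: norm_mult del: of_real_diff)
    ultimately show ?thesis using s_lt[OF that] by linarith
  qed
  have w1: "norm (w z) < 1" if "norm z < 1" for z
    using den[OF that] by (simp add: w_def norm_divide divide_less_eq_1) 
  have hols: "s holomorphic_on unit_disc"
    unfolding s_def using pc by (intro holomorphic_intros deriv_quotient_holomorphic[OF J]) auto
  have "subordinate E (\<lambda>z. (1 + of_real A * z) / (1 + of_real B * z))"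
    unfolding subordinate_def
  proof (intro conjI exI[of _ w] ballI)
    show "E holomorphic_on unit_disc"
      by (rule holomorphic_transform[of "\<lambda>z. 1 - s z"]) (use E hols in \<open>auto intro!: holomorphic_intros\<close>)
    show "(\<lambda>z. (1 + of_real A * z) / (1 + of_real B * z)) holomorphic_on unit_disc"
      by (intro holomorphic_intros) (use one_plus_mult_nonzero[of B] B0 B1 in auto)
    show "w holomorphic_on unit_disc"
      unfolding w_def using den by (intro holomorphic_intros hols) force
    show "w 0 = 0" using s_le[of 0] by (simp add: w_def)
    fix z :: complex assume "z \<in> unit_disc"
    then have z: "norm z < 1" by simp
    show "norm (w z) < 1" by (rule w1[OF z])
    define d where "d = of_real (B - A) - of_real B * s z"
    have "d \<noteq> 0" using den[OF z] by (auto simp: d_def)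
    then have "1 + of_real A * w z = (1 - s z) * (of_real (B - A) / d)"
         "1 + of_real B * w z = of_real (B - A) / d"
      by (simp_all add: w_def d_def[symmetric] divide_simps) (simp_all add: d_def algebra_simps)
    then show "E z = (1 + of_real A * w z) / (1 + of_real B * w z)"
      using \<open>d \<noteq> 0\<close> AB by (simp add: E[OF z])
  qed
  with cA have "f \<in> class_P n p \<delta> lam \<mu> l A B \<sigma>"
    by (simp add: class_P_def E_def)
  then show ?thesis
    unfolding class_P_neg_def using shifted c(1)
    by (auto intro!: exI[of _ "\<lambda>k. complex_of_real (c k)"])
qed

end

section \<open>Quasi-convolution\<close>

lemma has_neg_coeffs_unique:
  assumes "has_neg_coeffs n p c f" "has_neg_coeffs n p d f"
  shows "c = d"
proof
  fix k
  have "complex_of_real (c k) = of_real (d k)"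
    using has_neg_coeffs_fps_nth[OF assms(1), of k] has_neg_coeffs_fps_nth[OF assms(2), of k] by simp
  then show "c k = d k" by simp
qed

lemma quasi_conv_has_neg_coeffs:
  assumes f: "has_neg_coeffs n p c f" and g: "has_neg_coeffs n p d g" and n: "1 \<le> n"
    and bd: "\<And>k. d k \<le> K"
  shows "has_neg_coeffs n p (\<lambda>k. d k * c k) (quasi_conv n p f g)"
  unfolding has_neg_coeffs_def
proof (intro conjI allI ballI impI)
  note c = has_neg_coeffsD[OF f] and d = has_neg_coeffsD[OF g]
  show "0 \<le> d k * c k" for k using c(1) d(1) by simp
  show "d k * c k = 0" if "k < n + p" for k using c(2)[OF that] by simp
  fix z :: complex assume "z \<in> unit_disc"
  then have z: "norm z < 1" by simp
  have "summable (\<lambda>k. of_real (d k * c k) * z ^ k)"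
    by (rule summable_powser_weight[where m = 0 and C = K and N = 0, OF _ _ z])
      (use c(3) d(1) bd in \<open>auto simp: sums_iff\<close>)
  then have s: "(\<lambda>k. of_real (d k * c k) * z ^ k) sums (\<Sum>k. of_real (d k * c k) * z ^ k)" (is "_ sums ?S")
    by (rule summable_sums)
  then have "(\<lambda>k. of_real (d (k + (n + p)) * c (k + (n + p))) * z ^ (k + (n + p))) sums ?S"
    by (subst sums_zero_iff_shift) (use c in auto)
  moreover have "(\<lambda>k. of_real (d (k + (n + p)) * c (k + (n + p))) * z ^ (k + (n + p)))
    = (\<lambda>k. of_real (norm (fps_nth (fps_expansion f 0) (n + p + k))
                 * norm (fps_nth (fps_expansion g 0) (n + p + k))) * z ^ (n + p + k))"
    using n c(1) d(1) by (simp add: has_neg_coeffs_fps_nth[OF f] has_neg_coeffs_fps_nth[OF g] add_ac mult_ac)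
  ultimately have "quasi_conv n p f g z = z ^ p - ?S"
    by (simp add: quasi_conv_def sums_iff)
  with s show "(\<lambda>k. of_real (d k * c k) * z ^ k) sums (z ^ p - quasi_conv n p f g z)" by simp
qed

lemma quasi_conv_upto_1: "quasi_conv_upto n p (Suc 0) f = f (Suc 0)"
  by (simp add: quasi_conv_upto_def)

lemma quasi_conv_upto_Suc:
  assumes "1 \<le> m"
  shows "quasi_conv_upto n p (Suc m) f = quasi_conv n p (quasi_conv_upto n p m f) (f (Suc m))"
proof -
  have "[2..<Suc (Suc m)] = [2..<Suc m] @ [Suc m]" using assms by simp
  then show ?thesis unfolding quasi_conv_upto_def by simp
qed

context quasi_convolution
begin

text \<open>The smallest of the weights \<open>k (1 + B) \<Phi> k\<close> for \<open>k \<ge> n + p\<close>.\<close>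

definition min_weight :: real where "min_weight = real (n + p) * (1 + B) * \<Phi> (n + p)"

lemma min_weight_ge: "real (n + p) * (1 + B) \<le> min_weight"
  using mult_left_mono[OF Phi_ge_1[of "n + p"], of "real (n + p) * (1 + B)"] B0
  by (simp add: min_weight_def)

lemma min_weight_ge_1: "1 \<le> min_weight"
proof -
  have "1 * 1 \<le> real (n + p) * (1 + B)" using n B0 by (intro mult_mono) auto
  with min_weight_ge show ?thesis by linarith
qed

lemma coeff_bound_pointwise:
  assumes f: "has_neg_coeffs n p d g" and bd: "coeff_bound d Y"
  shows "min_weight * d k \<le> Y"
proof (cases "k < n + p")
  case True
  have "0 \<le> Y" using bd unfolding coeff_bound_def by (auto dest: spec[of _ 0])
  then show ?thesis using has_neg_coeffsD(2)[OF f True] by simp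
next
  case False
  have "\<Phi> (n + p) \<le> \<Phi> k" using False by (intro Phi_mono) auto
  then have "min_weight \<le> real k * (1 + B) * \<Phi> k"
    unfolding min_weight_def using False B0 by (intro mult_mono) (auto simp: Phi_def)
  then have "min_weight * d k \<le> real k * (1 + B) * \<Phi> k * d k"
    using has_neg_coeffsD(1)[OF f] by (intro mult_right_mono)
  also have "\<dots> \<le> (\<Sum>i<Suc k. real i * (1 + B) * \<Phi> i * d i)"
    using has_neg_coeffsD(1)[OF f] B0
    by (intro member_le_sum[of k _ "\<lambda>i. real i * (1 + B) * \<Phi> i * d i"]) (auto simp: Phi_def)
  also have "\<dots> \<le> Y" using bd by (simp only: coeff_bound_def)
  finally show ?thesis .
qed

text \<open>Each coefficient of the second factor is at most \<open>Y / min_weight\<close>; pulling this constant out of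
  the weighted sum leaves the sum of the first factor.\<close>

lemma coeff_bound_quasi_conv:
  assumes f: "has_neg_coeffs n p c f" "coeff_bound c X"
    and g: "has_neg_coeffs n p d g" "coeff_bound d Y"
  shows "has_neg_coeffs n p (\<lambda>k. d k * c k) (quasi_conv n p f g)"
    "coeff_bound (\<lambda>k. d k * c k) (X * Y / min_weight)"
proof -
  have d: "d k \<le> Y / min_weight" for k
    using coeff_bound_pointwise[OF g, of k] min_weight_ge_1 by (simp add: field_simps)
  show "has_neg_coeffs n p (\<lambda>k. d k * c k) (quasi_conv n p f g)"
    by (rule quasi_conv_has_neg_coeffs[OF f(1) g(1) n d])
  show "coeff_bound (\<lambda>k. d k * c k) (X * Y / min_weight)"
    unfolding coeff_bound_def
  proof
    fix N
    have "(\<Sum>k<N. real k * (1 + B) * \<Phi> k * (d k * c k)) \<le> (\<Sum>k<N. Y / min_weight * (real k * (1 + B) * \<Phi> k * c k))"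
    proof (rule sum_mono)
      fix k
      have "d k * (real k * (1 + B) * \<Phi> k * c k) \<le> Y / min_weight * (real k * (1 + B) * \<Phi> k * c k)"
        using d[of k] has_neg_coeffsD(1)[OF f(1)] B0 by (intro mult_right_mono) (auto simp: Phi_def)
      then show "real k * (1 + B) * \<Phi> k * (d k * c k) \<le> Y / min_weight * (real k * (1 + B) * \<Phi> k * c k)"
        by (simp add: mult_ac)
    qed
    also have "\<dots> = Y / min_weight * (\<Sum>k<N. real k * (1 + B) * \<Phi> k * c k)" by (simp add: sum_distrib_left)
    also have "\<dots> \<le> Y / min_weight * X"
    proof (rule mult_left_mono)
      show "0 \<le> Y / min_weight" using d[of 0] has_neg_coeffsD(1)[OF g(1), of 0] by linarith
    qed (use f(2) in \<open>simp add: coeff_bound_def\<close>)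
    finally show "(\<Sum>k<N. real k * (1 + B) * \<Phi> k * (d k * c k)) \<le> X * Y / min_weight" by (simp add: mult.commute)
  qed
qed

lemma coeff_bound_quasi_conv_upto:
  assumes "1 \<le> m" "\<And>j. j \<in> {1..m} \<Longrightarrow> \<exists>c. has_neg_coeffs n p c (f j) \<and> coeff_bound c (X j)"
  shows "\<exists>c. has_neg_coeffs n p c (quasi_conv_upto n p m f) \<and> coeff_bound c ((\<Prod>j=1..m. X j) / min_weight ^ (m - 1))"
  using assms
proof (induction m rule: nat_induct_at_least)
  case base
  then show ?case by (auto simp: quasi_conv_upto_1)
next
  case (Suc m)
  obtain c where c: "has_neg_coeffs n p c (quasi_conv_upto n p m f)" "coeff_bound c ((\<Prod>j=1..m. X j) / min_weight ^ (m - 1))"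
    using Suc.IH Suc.prems by auto
  obtain d where d: "has_neg_coeffs n p d (f (Suc m))" "coeff_bound d (X (Suc m))"
    using Suc.prems by auto
  have "min_weight ^ m = min_weight ^ (m - 1) * min_weight" using Suc.hyps by (metis Suc_diff_1 Suc_le_eq One_nat_def power_Suc2)
  then have eq: "(\<Prod>j=1..m. X j) / min_weight ^ (m - 1) * X (Suc m) / min_weight = (\<Prod>j=1..Suc m. X j) / min_weight ^ (Suc m - 1)"
    by simp
  show ?case
    using coeff_bound_quasi_conv[OF c d] unfolding eq quasi_conv_upto_Suc[OF Suc.hyps] by blast
qed

lemma has_neg_coeffs_monomial:
  assumes "0 \<le> x"
  shows "has_neg_coeffs n p (\<lambda>k. if k = n + p then x else 0) (\<lambda>z. z ^ p - of_real x * z ^ (p + n))"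
  unfolding has_neg_coeffs_def
proof (intro conjI allI ballI impI)
  fix z :: complex
  have "(\<lambda>k. if k = n + p then of_real x * z ^ k else 0) sums (of_real x * z ^ (n + p))"
    by (rule sums_single)
  then show "(\<lambda>k. of_real (if k = n + p then x else 0) * z ^ k) sums
      (z ^ p - (z ^ p - of_real x * z ^ (p + n)))"
    by (simp add: add.commute if_distrib[of of_real] if_distrib[of "\<lambda>x. x * _"] cong: if_cong)
qed (use assms in auto)

text \<open>A single term at the exponent of smallest weight exhausts the coefficient bound; these are the
  extremal functions.\<close>

lemma coeff_bound_monomial:
  assumes "0 \<le> x"
  shows "coeff_bound (\<lambda>k. if k = n + p then x / min_weight else 0) x"
  unfolding coeff_bound_def
proof
  fix N
  have "(\<Sum>k<N. real k * (1 + B) * \<Phi> k * (if k = n + p then x / min_weight else 0))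
      = (\<Sum>k<N. if k = n + p then min_weight * (x / min_weight) else 0)"
    by (intro sum.cong) (auto simp: min_weight_def)
  also have "\<dots> \<le> x" using assms min_weight_ge_1 by simp
  finally show "(\<Sum>k<N. real k * (1 + B) * \<Phi> k * (if k = n + p then x / min_weight else 0)) \<le> x" .
qed

lemma quasi_conv_upto_monomials:
  assumes "1 \<le> m" "\<And>j. j \<in> {1..m} \<Longrightarrow> 0 \<le> x j"
  shows "has_neg_coeffs n p (\<lambda>k. if k = n + p then \<Prod>j=1..m. x j else 0)
    (quasi_conv_upto n p m (\<lambda>j z. z ^ p - of_real (x j) * z ^ (p + n)))"
  using assms
proof (induction m rule: nat_induct_at_least)
  case base
  then show ?case using has_neg_coeffs_monomial[of "x 1"] by (simp add: quasi_conv_upto_1 cong: if_cong)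
next
  case (Suc m)
  define d where "d = (\<lambda>k. if k = n + p then x (Suc m) else 0)"
  define c where "c = (\<lambda>k. if k = n + p then \<Prod>j=1..m. x j else 0)"
  have "has_neg_coeffs n p (\<lambda>k. d k * c k) (quasi_conv n p
     (quasi_conv_upto n p m (\<lambda>j z. z ^ p - of_real (x j) * z ^ (p + n)))
     (\<lambda>z. z ^ p - of_real (x (Suc m)) * z ^ (p + n)))"
  proof (rule quasi_conv_has_neg_coeffs[OF _ _ n, of _ _ _ _ _ "x (Suc m)"])
    show "has_neg_coeffs n p c (quasi_conv_upto n p m (\<lambda>j z. z ^ p - of_real (x j) * z ^ (p + n)))"
      unfolding c_def using Suc.IH Suc.prems by auto
    show "has_neg_coeffs n p d (\<lambda>z. z ^ p - of_real (x (Suc m)) * z ^ (p + n))"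
      unfolding d_def using Suc.prems by (intro has_neg_coeffs_monomial) auto
    show "d k \<le> x (Suc m)" for k using Suc.prems by (auto simp: d_def)
  qed
  moreover have "(\<lambda>k. d k * c k) = (\<lambda>k. if k = n + p then \<Prod>j=1..Suc m. x j else 0)"
    by (auto simp: d_def c_def fun_eq_iff)
  ultimately show ?case using Suc.hyps by (simp add: quasi_conv_upto_Suc)
qed

end

theorem theorem6p1:
  fixes n p m :: nat and lam \<mu> l \<delta> A B \<Upsilon> :: real and \<sigma> :: "nat \<Rightarrow> real"
    and F :: "nat \<Rightarrow> complex \<Rightarrow> complex"
  assumes "n \<ge> 1" "p \<ge> 1" "m \<ge> 1"
    and "lam \<ge> \<mu>" "\<mu> \<ge> 0" "l \<ge> 0" "\<delta> \<ge> 0"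
    and "-1 \<le> A" "A < B" "B \<le> 1" "0 < B"
    and "\<And>j. j \<in> {1..m} \<Longrightarrow> 0 \<le> \<sigma> j \<and> \<sigma> j < real p"
  defines "\<Upsilon> \<equiv> real p - (\<Prod>j=1..m. (B - A) * (real p - \<sigma> j)) /
      ((B - A) * (real (n + p) * (1 + B) * Phi p \<delta> lam \<mu> l (n + p)) ^ (m - 1))"
  defines "F \<equiv> \<lambda>j z. z ^ p - of_real ((B - A) * (real p - \<sigma> j) /
      (real (n + p) * (1 + B) * Phi p \<delta> lam \<mu> l (n + p))) * z ^ (p + n)"
  shows "0 \<le> \<Upsilon> \<and> \<Upsilon> < real p \<and>
    (\<forall>f :: nat \<Rightarrow> complex \<Rightarrow> complex.
       (\<forall>j \<in> {1..m}. f j \<in> class_P_neg n p \<delta> lam \<mu> l A B (\<sigma> j)) \<longrightarrow>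
       quasi_conv_upto n p m f \<in> class_P_neg n p \<delta> lam \<mu> l A B \<Upsilon>) \<and>
    (\<forall>j \<in> {1..m}. F j \<in> class_P_neg n p \<delta> lam \<mu> l A B (\<sigma> j)) \<and>
    (\<forall>\<Upsilon>'. \<Upsilon> < \<Upsilon>' \<and> \<Upsilon>' < real p \<longrightarrow>
       quasi_conv_upto n p m F \<notin> class_P_neg n p \<delta> lam \<mu> l A B \<Upsilon>')"
proof -
  interpret quasi_convolution n p \<delta> lam \<mu> l A B
    using assms(1,2,4-11) by unfold_locales
  define X where "X = (\<lambda>j. (B - A) * (real p - \<sigma> j))"
  define P where "P = (\<Prod>j=1..m. X j)"
  have M0: "min_weight > 0" using min_weight_ge_1 by simp
  have X: "0 < X j" "X j \<le> min_weight" if "j \<in> {1..m}" for j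
  proof -
    note s = assms(12)[OF that]
    show "0 < X j" using s AB by (simp add: X_def)
    have "X j \<le> (1 + B) * real (n + p)"
      unfolding X_def using s A AB by (intro mult_mono) auto
    with min_weight_ge show "X j \<le> min_weight" by (simp add: mult.commute)
  qed
  have \<Upsilon>: "\<Upsilon> = real p - P / ((B - A) * min_weight ^ (m - 1))"
    by (simp only: \<Upsilon>_def P_def X_def min_weight_def)
  \<comment> \<open>\<open>\<Upsilon>\<close> is the number for which the admissible weighted coefficient sum \<open>(B - A)(p - \<Upsilon>)\<close>
    equals the bound obtained for the convolution.\<close>
  then have gap: "(B - A) * (real p - \<Upsilon>) = P / min_weight ^ (m - 1)"
    using AB by simp
  have P0: "0 < P" unfolding P_def using X by (intro prod_pos) auto
  have F_eq: "F = (\<lambda>j z. z ^ p - of_real (X j / min_weight) * z ^ (p + n))"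
    by (simp only: F_def X_def min_weight_def)
  have "\<Upsilon> < real p" using P0 M0 AB by (simp add: \<Upsilon>)
  moreover have "0 \<le> \<Upsilon>"
  proof -
    have m: "m = Suc (m - 1)" using assms(3) by simp
    have "P = X 1 * (\<Prod>j=2..m. X j)"
      unfolding P_def using assms(3) by (subst prod.atLeast_Suc_atMost) (auto simp: numeral_2_eq_2)
    also have "\<dots> \<le> X 1 * min_weight ^ (m - 1)"
    proof (rule mult_left_mono)
      have "(\<Prod>j=2..m. X j) \<le> (\<Prod>j=2..m. min_weight)"
        using X by (intro prod_mono) (auto simp: less_imp_le)
      then show "(\<Prod>j=2..m. X j) \<le> min_weight ^ (m - 1)" by simp
    qed (use X[of 1] assms(3) in auto)
    also have "\<dots> \<le> ((B - A) * real p) * min_weight ^ (m - 1)"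
      using assms(12)[of 1] assms(3) AB M0 by (intro mult_right_mono) (auto simp: X_def)
    finally have "P / ((B - A) * min_weight ^ (m - 1)) \<le> real p"
      using M0 AB by (simp add: divide_le_eq mult_ac)
    then show ?thesis by (simp add: \<Upsilon>)
  qed
  moreover have "quasi_conv_upto n p m f \<in> class_P_neg n p \<delta> lam \<mu> l A B \<Upsilon>"
    if f: "\<forall>j \<in> {1..m}. f j \<in> class_P_neg n p \<delta> lam \<mu> l A B (\<sigma> j)" for f
  proof -
    have "\<exists>c. has_neg_coeffs n p c (f j) \<and> coeff_bound c (X j)" if "j \<in> {1..m}" for j
      using class_P_neg_imp_coeff_bound f assms(12) that unfolding X_def by metis
    then obtain c where "has_neg_coeffs n p c (quasi_conv_upto n p m f)" "coeff_bound c (P / min_weight ^ (m - 1))"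
      using coeff_bound_quasi_conv_upto[of m f X, OF assms(3)] unfolding P_def by blast
    then show ?thesis
      using \<open>0 \<le> \<Upsilon>\<close> \<open>\<Upsilon> < real p\<close> by (intro coeff_bound_imp_class_P_neg) (simp_all add: gap)
  qed
  moreover have "F j \<in> class_P_neg n p \<delta> lam \<mu> l A B (\<sigma> j)" if j: "j \<in> {1..m}" for j
  proof (rule coeff_bound_imp_class_P_neg)
    show "has_neg_coeffs n p (\<lambda>k. if k = n + p then X j / min_weight else 0) (F j)"
      unfolding F_eq using X(1)[OF j] M0 by (intro has_neg_coeffs_monomial) simp
    show "coeff_bound (\<lambda>k. if k = n + p then X j / min_weight else 0) ((B - A) * (real p - \<sigma> j))"
      using coeff_bound_monomial[of "X j"] X(1)[OF j] by (simp add: X_def)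
  qed (use assms(12)[OF j] in auto)
  moreover have "quasi_conv_upto n p m F \<notin> class_P_neg n p \<delta> lam \<mu> l A B \<Upsilon>'"
    if \<Upsilon>': "\<Upsilon> < \<Upsilon>'" "\<Upsilon>' < real p" for \<Upsilon>'
  proof
    assume "quasi_conv_upto n p m F \<in> class_P_neg n p \<delta> lam \<mu> l A B \<Upsilon>'"
    then obtain c where c: "has_neg_coeffs n p c (quasi_conv_upto n p m F)"
      "coeff_bound c ((B - A) * (real p - \<Upsilon>'))"
      using class_P_neg_imp_coeff_bound \<Upsilon>' by blast
    \<comment> \<open>The convolution of the extremal functions has a single coefficient, whose weighted size is
      exactly \<open>P / min_weight\<^bsup>m-1\<^esup>\<close>.\<close>
    have "has_neg_coeffs n p (\<lambda>k. if k = n + p then \<Prod>j=1..m. X j / min_weight else 0) (quasi_conv_upto n p m F)"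
      unfolding F_eq by (rule quasi_conv_upto_monomials[OF assms(3)]) (use X M0 in \<open>simp add: less_imp_le\<close>)
    from has_neg_coeffs_unique[OF c(1) this] have "c (n + p) = P / min_weight ^ m"
      by (simp add: P_def prod_dividef)
    moreover have "min_weight ^ m = min_weight * min_weight ^ (m - 1)" using assms(3) by (simp flip: power_Suc)
    ultimately have "P / min_weight ^ (m - 1) \<le> (B - A) * (real p - \<Upsilon>')"
      using coeff_bound_pointwise[OF c, of "n + p"] M0 by simp
    then have "(B - A) * (real p - \<Upsilon>) \<le> (B - A) * (real p - \<Upsilon>')" by (simp only: gap)
    then show False using AB \<Upsilon>' by simp
  qed
  ultimately show ?thesis by blast
qed

end
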